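(* Consider the conditional disclosure of secrets (CDS) instance with $X=Y=3$, $\mathcal{I}=\{1,2,3\}\times\{1,2,3\}$, and $f:\mathcal{I}\to\{0,1\}$ given by $$f(1,1)=f(2,1)=f(2,2)=f(3,2)=f(3,3)=1,\qquad f(1,2)=f(1,3)=f(2,3)=f(3,1)=0,$$ that is, the qualified edges are $\{A_1,B_1\},\{B_1,A_2\},\{A_2,B_2\},\{B_2,A_3\},\{A_3,B_3\}$ and the unqualified edges are $\{B_2,A_1\},\{A_1,B_3\},\{B_3,A_2\},\{B_1,A_3\}$. The linear capacity of this CDS instance is $2/5$.
   Context: CDS instance. Let $X,Y$ be positive integers, $\mathcal{I}\subset\{1,\dots,X\}\times\{1,\dots,Y\}$, and $f:\mathcal{I}\to\{0,1\}$. The signals $A_1,\dots,A_X,B_1,\dots,B_Y$ are regarded as vertices; for $(x,y)\in\mathcal{I}$ the pair $\{A_x,B_y\}$ is a qualified edge if $f(x,y)=1$ and an unqualified edge if $f(x,y)=0$. Linear CDS scheme. It consists of a finite field $\mathbb{F}_p$, positive integers $L, L_Z, N$, a uniformly distributed secret $S\in\mathbb{F}_p^{L\times 1}$ and an independent uniformly distributed noise $Z\in\mathbb{F}_p^{L_Z\times 1}$, and for every signal $v\in\{A_1,\dots,A_X,B_1,\dots,B_Y\}$ matrices $\mathbf{F}_v\in\mathbb{F}_p^{N\times L}$, $\mathbf{H}_v\in\mathbb{F}_p^{N\times L_Z}$ with $v=\mathbf{F}_vS+\mathbf{H}_vZ$, such that for all $(x,y)\in\mathcal{I}$: (correctness)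 $H(S\mid A_x,B_y)=0$ if $f(x,y)=1$; (security) $H(S\mid A_x,B_y)=H(S)$ if $f(x,y)=0$. Here $H$ is Shannon entropy in $p$-ary units. Its rate is $R=L/(2N)$. The linear capacity is the supremum of $L/(2N)$ over all linear CDS schemes (with $p,L,L_Z,N$ chosen freely). *)

theory Defs
  imports
    "HOL-Probability.Information"
    "HOL-Library.Extended_Real"
    "HOL-Algebra.Ring"
begin

datatype signal = A nat | B nat

record cds_instance =
  num_A :: nat
  num_B :: nat
  index_pairs :: "(nat \<times> nat) set"
  disclose :: "nat \<times> nat \<Rightarrow> nat"

definition wf_cds_instance :: "cds_instance \<Rightarrow> bool" where
  "wf_cds_instance C \<longleftrightarrow>
     num_A C > 0 \<and> num_B C > 0 \<and>
     index_pairs C \<subseteq> {1..num_A C} \<times> {1..num_B C} \<and>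
     disclose C ` index_pairs C \<subseteq> {0, 1}"

definition signals :: "cds_instance \<Rightarrow> signal set" where
  "signals C = A ` {1..num_A C} \<union> B ` {1..num_B C}"

text \<open>
  The field and its size are part of a scheme, so the field must range over the values of one
  fixed type. Every finite field is isomorphic to one whose carrier is a set of natural numbers,
  so taking the carrier inside \<^typ>\<open>nat\<close> loses no generality; the ring operations are arbitrary
  and unrelated to the arithmetic of \<^typ>\<open>nat\<close>.

  Matrices are functions of a row and a column index, both counted from 0; only the entries
  within the stated dimensions matter.
\<close>

record linear_scheme =
  base_field :: "nat ring"
  secret_len :: nat
  noise_len :: nat
  signal_len :: nat
  secret_mat :: "signal \<Rightarrow> nat \<Rightarrow> nat \<Rightarrow> nat"
  noise_mat :: "signal \<Rightarrow> nat \<Rightarrow> nat \<Rightarrow> nat"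

definition vectors :: "nat ring \<Rightarrow> nat \<Rightarrow> (nat \<Rightarrow> nat) set" where
  "vectors K n = {..<n} \<rightarrow>\<^sub>E carrier K"

definition is_matrix :: "nat ring \<Rightarrow> nat \<Rightarrow> nat \<Rightarrow> (nat \<Rightarrow> nat \<Rightarrow> nat) \<Rightarrow> bool" where
  "is_matrix K m n M \<longleftrightarrow> (\<forall>i<m. \<forall>j<n. M i j \<in> carrier K)"

text \<open>
  The outcomes are the pairs of a secret and a noise vector. The uniform distribution on this
  product makes the two components uniform and independent.
\<close>

definition scheme_space :: "linear_scheme \<Rightarrow> ((nat \<Rightarrow> nat) \<times> (nat \<Rightarrow> nat)) measure" where
  "scheme_space \<sigma> = uniform_count_measure
     (vectors (base_field \<sigma>) (secret_len \<sigma>) \<times> vectors (base_field \<sigma>) (noise_len \<sigma>))"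

definition secret :: "(nat \<Rightarrow> nat) \<times> (nat \<Rightarrow> nat) \<Rightarrow> nat \<Rightarrow> nat" where
  "secret \<omega> = fst \<omega>"

definition noise :: "(nat \<Rightarrow> nat) \<times> (nat \<Rightarrow> nat) \<Rightarrow> nat \<Rightarrow> nat" where
  "noise \<omega> = snd \<omega>"

definition signal_value ::
  "linear_scheme \<Rightarrow> signal \<Rightarrow> (nat \<Rightarrow> nat) \<times> (nat \<Rightarrow> nat) \<Rightarrow> nat \<Rightarrow> nat" where
  "signal_value \<sigma> v \<omega> = (let K = base_field \<sigma> in
     (\<lambda>i\<in>{..<signal_len \<sigma>}.
       (\<Oplus>\<^bsub>K\<^esub>j\<in>{..<secret_len \<sigma>}. secret_mat \<sigma> v i j \<otimes>\<^bsub>K\<^esub> secret \<omega> j) \<oplus>\<^bsub>K\<^esub>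
       (\<Oplus>\<^bsub>K\<^esub>j\<in>{..<noise_len \<sigma>}. noise_mat \<sigma> v i j \<otimes>\<^bsub>K\<^esub> noise \<omega> j)))"

definition signal_pair ::
  "linear_scheme \<Rightarrow> nat \<Rightarrow> nat \<Rightarrow>
   (nat \<Rightarrow> nat) \<times> (nat \<Rightarrow> nat) \<Rightarrow> (nat \<Rightarrow> nat) \<times> (nat \<Rightarrow> nat)" where
  "signal_pair \<sigma> x y \<omega> = (signal_value \<sigma> (A x) \<omega>, signal_value \<sigma> (B y) \<omega>)"

definition shannon_entropy :: "linear_scheme \<Rightarrow>
    ((nat \<Rightarrow> nat) \<times> (nat \<Rightarrow> nat) \<Rightarrow> 'a) \<Rightarrow> real" where
  "shannon_entropy \<sigma> U =
     prob_space.entropy (scheme_space \<sigma>) (real (card (carrier (base_field \<sigma>))))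
       (count_space (U ` space (scheme_space \<sigma>))) U"

definition shannon_cond_entropy :: "linear_scheme \<Rightarrow>
    ((nat \<Rightarrow> nat) \<times> (nat \<Rightarrow> nat) \<Rightarrow> 'a) \<Rightarrow>
    ((nat \<Rightarrow> nat) \<times> (nat \<Rightarrow> nat) \<Rightarrow> 'b) \<Rightarrow> real" where
  "shannon_cond_entropy \<sigma> U V =
     prob_space.conditional_entropy (scheme_space \<sigma>) (real (card (carrier (base_field \<sigma>))))
       (count_space (U ` space (scheme_space \<sigma>))) (count_space (V ` space (scheme_space \<sigma>))) U V"

definition linear_cds_scheme :: "cds_instance \<Rightarrow> linear_scheme \<Rightarrow> bool" where
  "linear_cds_scheme C \<sigma> \<longleftrightarrow>
     field (base_field \<sigma>) \<and> finite (carrier (base_field \<sigma>)) \<and>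
     secret_len \<sigma> > 0 \<and> noise_len \<sigma> > 0 \<and> signal_len \<sigma> > 0 \<and>
     (\<forall>v \<in> signals C.
        is_matrix (base_field \<sigma>) (signal_len \<sigma>) (secret_len \<sigma>) (secret_mat \<sigma> v) \<and>
        is_matrix (base_field \<sigma>) (signal_len \<sigma>) (noise_len \<sigma>) (noise_mat \<sigma> v)) \<and>
     (\<forall>(x, y) \<in> index_pairs C.
        (disclose C (x, y) = 1 \<longrightarrow>
           shannon_cond_entropy \<sigma> secret (signal_pair \<sigma> x y) = 0) \<and>
        (disclose C (x, y) = 0 \<longrightarrow>
           shannon_cond_entropy \<sigma> secret (signal_pair \<sigma> x y) = shannon_entropy \<sigma> secret))"

definition rate :: "linear_scheme \<Rightarrow> real" where
  "rate \<sigma> = real (secret_len \<sigma>) / (2 * real (signal_len \<sigma>))"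

text \<open>
  The supremum is taken in \<^typ>\<open>ereal\<close>, where it always exists; on \<^typ>\<open>real\<close> the
  supremum of an unbounded or empty set would be an unspecified number.
\<close>

definition linear_capacity :: "cds_instance \<Rightarrow> ereal" where
  "linear_capacity C = (SUP \<sigma> \<in> {\<sigma>. linear_cds_scheme C \<sigma>}. ereal (rate \<sigma>))"

definition example_cds :: cds_instance where
  "example_cds = \<lparr> num_A = 3, num_B = 3, index_pairs = {1, 2, 3} \<times> {1, 2, 3},
     disclose = (\<lambda>p. if p \<in> {(1, 1), (2, 1), (2, 2), (3, 2), (3, 3)} then 1 else 0) \<rparr>"

lemma wf_example_cds: "wf_cds_instance example_cds"
  by (auto simp: wf_cds_instance_def example_cds_def)

lemma disclose_example:
  "disclose example_cds (1, 1) = 1" "disclose example_cds (2, 1) = 1"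
  "disclose example_cds (2, 2) = 1" "disclose example_cds (3, 2) = 1"
  "disclose example_cds (3, 3) = 1"
  "disclose example_cds (1, 2) = 0" "disclose example_cds (1, 3) = 0"
  "disclose example_cds (2, 3) = 0" "disclose example_cds (3, 1) = 0"
  by (simp_all add: example_cds_def)

end

theory Submission
  imports Defs "HOL-Algebra.Multiplicative_Group"
begin

text \<open>
  The qualified edges form the path \<open>A\<^sub>1 B\<^sub>1 A\<^sub>2 B\<^sub>2 A\<^sub>3 B\<^sub>3\<close>. For an edge \<open>{v, w}\<close> of this path and
  \<open>t \<in> K\<^sup>L\<close>, correctness and linear duality give coefficient vectors with
  \<open>t \<bullet> S = a(t) \<bullet> v + b(t) \<bullet> w\<close>. At each of the four inner vertices of the path add the coefficient
  vectors coming from the two adjacent edges; this maps \<open>(K\<^sup>L)\<^sup>5\<close> to \<open>(K\<^sup>N)\<^sup>4\<close>. If two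
  inputs collide, then at \<open>S = 0\<close> the differences of all their terms agree up to sign along the whole path.
  Security of \<open>{A\<^sub>1, B\<^sub>2}\<close>, \<open>{A\<^sub>1, B\<^sub>3}\<close>, \<open>{A\<^sub>2, B\<^sub>3}\<close> carries this over to all \<open>S\<close>, so the
  two inputs agree on the middle edge \<open>{A\<^sub>2, B\<^sub>2}\<close>, and from there on all other edges. Hence the map
  is injective and \<open>5 L \<le> 4 N\<close>.

  A scheme over the field with two elements with \<open>L = 4\<close> and \<open>N = 5\<close> attains the bound.
\<close>

subsection \<open>Conditional entropy under the uniform distribution\<close>

lemma uniform_information_space:
  fixes b :: real
  assumes "finite \<Omega>" "\<Omega> \<noteq> {}" "b > 1"
  shows "information_space (uniform_count_measure \<Omega>) b"
proof -
  interpret prob_space "uniform_count_measure \<Omega>"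
    using assms by (intro prob_space_uniform_count_measure)
  show ?thesis
    by unfold_locales (rule assms)
qed

lemma simple_function_uniform_count_measure:
  assumes "finite \<Omega>"
  shows "simple_function (uniform_count_measure \<Omega>) X"
  using assms by (auto simp: simple_function_def space_uniform_count_measure)

lemma uniform_simple_distributed:
  assumes fin: "finite \<Omega>" and ne: "\<Omega> \<noteq> {}"
  shows "simple_distributed (uniform_count_measure \<Omega>) X
           (\<lambda>x. card {\<omega>\<in>\<Omega>. X \<omega> = x} / card \<Omega>)"
proof -
  interpret prob_space "uniform_count_measure \<Omega>"
    using assms by (rule prob_space_uniform_count_measure)
  have "X -` {x} \<inter> \<Omega> = {\<omega>\<in>\<Omega>. X \<omega> = x}" for x by auto
  then show ?thesis
    by (intro simple_distributedI simple_function_uniform_count_measure fin)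
      (auto simp: fin space_uniform_count_measure measure_uniform_count_measure)
qed

lemma card_fibre_pos:
  assumes "finite \<Omega>" "\<omega> \<in> \<Omega>"
  shows "0 < card {\<omega>'\<in>\<Omega>. X \<omega>' = X \<omega>}"
  using assms by (auto simp: card_gt_0_iff)

text \<open>The conditional entropy is a sum of nonnegative terms
  \<open>p w * log b (q (snd w) / p w)\<close>, so it vanishes only if every fibre of the pair
  \<open>(U, V)\<close> fills the fibre of \<open>V\<close> that contains it. Uniformity reduces the
  comparison of probabilities to one of cardinalities.\<close>

lemma uniform_cond_entropy_eq_0_iff:
  fixes U :: "'a \<Rightarrow> 'b" and V :: "'a \<Rightarrow> 'c" and b :: real
  assumes fin: "finite \<Omega>" and ne: "\<Omega> \<noteq> {}" and b: "b > 1"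
  shows "prob_space.conditional_entropy (uniform_count_measure \<Omega>) b
           (count_space (U ` \<Omega>)) (count_space (V ` \<Omega>)) U V = 0 \<longleftrightarrow>
         (\<forall>\<omega>\<in>\<Omega>. \<forall>\<omega>'\<in>\<Omega>. V \<omega> = V \<omega>' \<longrightarrow> U \<omega> = U \<omega>')"
proof -
  interpret information_space "uniform_count_measure \<Omega>" b
    using assms by (rule uniform_information_space)
  let ?M = "uniform_count_measure \<Omega>"
  let ?W = "\<lambda>\<omega>. (U \<omega>, V \<omega>)"
  let ?A = "\<lambda>w. {\<omega>\<in>\<Omega>. ?W \<omega> = w}" and ?B = "\<lambda>v. {\<omega>\<in>\<Omega>. V \<omega> = v}"
  define p where "p = (\<lambda>w. card (?A w) / card \<Omega>)"
  define q where "q = (\<lambda>v. card (?B v) / card \<Omega>)"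
  have cO: "card \<Omega> > 0" using fin ne by (simp add: card_gt_0_iff)
  have V: "simple_distributed ?M V q"
    unfolding p_def q_def by (rule uniform_simple_distributed[OF fin ne])
  have W: "simple_distributed ?M ?W p"
    unfolding p_def q_def by (rule uniform_simple_distributed[OF fin ne])
  have pos: "0 < p w" "p w \<le> q (snd w)" if "w \<in> ?W ` \<Omega>" for w
    using that cO fin
    by (auto simp: p_def q_def intro!: divide_right_mono card_mono divide_pos_pos card_fibre_pos[of _ _ ?W, simplified])
  have eq: "conditional_entropy b (count_space (U ` \<Omega>)) (count_space (V ` \<Omega>)) U V =
      (\<Sum>w\<in>?W ` \<Omega>. p w * log b (q (snd w) / p w))"
  proof -
    have "- (p w * log b (p w / q (snd w))) = p w * log b (q (snd w) / p w)"
      if "w \<in> ?W ` \<Omega>" for w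
    proof -
      have "0 < q (snd w)" using pos[OF that] by linarith
      then show ?thesis
        using pos[OF that] by (simp add: log_divide_pos algebra_simps)
    qed
    then show ?thesis
      using conditional_entropy_eq[OF V W]
      by (simp add: space_uniform_count_measure split_beta flip: sum_negf)
  qed
  have nonneg: "0 \<le> p w * log b (q (snd w) / p w)" if "w \<in> ?W ` \<Omega>" for w
    using pos[OF that] b by (auto intro!: mult_nonneg_nonneg)
  have "(\<Sum>w\<in>?W ` \<Omega>. p w * log b (q (snd w) / p w)) = 0 \<longleftrightarrow> 
      (\<forall>w\<in>?W ` \<Omega>. p w * log b (q (snd w) / p w) = 0)"
    using fin nonneg by (intro sum_nonneg_eq_0_iff) auto
  also have "\<dots> \<longleftrightarrow> (\<forall>w\<in>?W ` \<Omega>. p w = q (snd w))"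
  proof (intro ball_cong refl)
    fix w assume "w \<in> ?W ` \<Omega>"
    from pos[OF this] b show "p w * log b (q (snd w) / p w) = 0 \<longleftrightarrow> p w = q (snd w)"
      by (auto simp: log_def)
  qed
  also have "\<dots> \<longleftrightarrow> (\<forall>w\<in>?W ` \<Omega>. ?A w = ?B (snd w))"
  proof (intro ball_cong refl)
    fix w assume "w \<in> ?W ` \<Omega>"
    have "?A w \<subseteq> ?B (snd w)" and "finite (?B (snd w))" using fin by auto
    from card_subset_eq[OF this(2,1)]
    have "card (?A w) = card (?B (snd w)) \<longleftrightarrow> ?A w = ?B (snd w)"
      by (intro iffI) simp_all
    with cO show "p w = q (snd w) \<longleftrightarrow> ?A w = ?B (snd w)"
      by (simp add: p_def q_def)
  qed
  also have "\<dots> \<longleftrightarrow> (\<forall>\<omega>\<in>\<Omega>. \<forall>\<omega>'\<in>\<Omega>. V \<omega> = V \<omega>' \<longrightarrow> U \<omega> = U \<omega>')"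
  proof
    assume *: "\<forall>w\<in>?W ` \<Omega>. ?A w = ?B (snd w)"
    show "\<forall>\<omega>\<in>\<Omega>. \<forall>\<omega>'\<in>\<Omega>. V \<omega> = V \<omega>' \<longrightarrow> U \<omega> = U \<omega>'"
    proof (intro ballI impI)
      fix \<omega> \<omega>' assume \<omega>: "\<omega> \<in> \<Omega>" "\<omega>' \<in> \<Omega>" "V \<omega> = V \<omega>'"
      then have "\<omega> \<in> ?A (?W \<omega>')" using * by fastforce
      then show "U \<omega> = U \<omega>'" by simp
    qed
  next
    assume *: "\<forall>\<omega>\<in>\<Omega>. \<forall>\<omega>'\<in>\<Omega>. V \<omega> = V \<omega>' \<longrightarrow> U \<omega> = U \<omega>'"
    then show "\<forall>w\<in>?W ` \<Omega>. ?A w = ?B (snd w)"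
      by (intro ballI set_eqI) (metis (mono_tags, lifting) imageE mem_Collect_eq prod.inject snd_conv)
  qed
  finally show ?thesis using eq by simp
qed

text \<open>Independence enters as a counting identity on fibres. It makes the mutual information
  vanish, which is the difference of the two entropies.\<close>

lemma uniform_cond_entropy_eq_entropyI:
  fixes U :: "'a \<Rightarrow> 'b" and V :: "'a \<Rightarrow> 'c" and b :: real
  assumes fin: "finite \<Omega>" and ne: "\<Omega> \<noteq> {}" and b: "b > 1"
    and indep: "\<And>u v. u \<in> U ` \<Omega> \<Longrightarrow> v \<in> V ` \<Omega> \<Longrightarrow> card {\<omega>\<in>\<Omega>. U \<omega> = u \<and> V \<omega> = v} * card \<Omega> =
        card {\<omega>\<in>\<Omega>. U \<omega> = u} * card {\<omega>\<in>\<Omega>. V \<omega> = v}"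
  shows "prob_space.conditional_entropy (uniform_count_measure \<Omega>) b
           (count_space (U ` \<Omega>)) (count_space (V ` \<Omega>)) U V =
         prob_space.entropy (uniform_count_measure \<Omega>) b (count_space (U ` \<Omega>)) U"
proof -
  interpret information_space "uniform_count_measure \<Omega>" b
    using fin ne b by (rule uniform_information_space)
  let ?M = "uniform_count_measure \<Omega>"
  have sf: "simple_function ?M X" for X :: "'a \<Rightarrow> 'd"
    by (rule simple_function_uniform_count_measure[OF fin])
  have cO: "card \<Omega> > 0" using fin ne by (simp add: card_gt_0_iff)
  have "mutual_information b (count_space (U ` space ?M)) (count_space (V ` space ?M)) U V = 0"
  proof (rule mutual_information_eq_0_simple)
    show "simple_distributed ?M U (\<lambda>u. card {\<omega>\<in>\<Omega>. U \<omega> = u} / card \<Omega>)"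
      by (rule uniform_simple_distributed[OF fin ne])
    show "simple_distributed ?M V (\<lambda>u. card {\<omega>\<in>\<Omega>. V \<omega> = u} / card \<Omega>)"
      by (rule uniform_simple_distributed[OF fin ne])
    show "simple_distributed ?M (\<lambda>\<omega>. (U \<omega>, V \<omega>)) (\<lambda>w. card {\<omega>\<in>\<Omega>. (U \<omega>, V \<omega>) = w} / card \<Omega>)"
      by (rule uniform_simple_distributed[OF fin ne])
    have "real (card {\<omega>\<in>\<Omega>. U \<omega> = u \<and> V \<omega> = v}) * real (card \<Omega>) =
        real (card {\<omega>\<in>\<Omega>. U \<omega> = u}) * real (card {\<omega>\<in>\<Omega>. V \<omega> = v})"
      if "u \<in> U ` \<Omega>" "v \<in> V ` \<Omega>" for u v
      using indep[OF that] by (simp flip: of_nat_mult)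
    then show "\<forall>x\<in>space ?M. card {\<omega>\<in>\<Omega>. (U \<omega>, V \<omega>) = (U x, V x)} / card \<Omega> =
        card {\<omega>\<in>\<Omega>. U \<omega> = U x} / card \<Omega> * (card {\<omega>\<in>\<Omega>. V \<omega> = V x} / card \<Omega>)"
      using cO by (simp add: space_uniform_count_measure field_simps)
  qed
  then show ?thesis
    using mutual_information_eq_entropy_conditional_entropy[OF sf sf, of U V]
    by (simp add: space_uniform_count_measure)
qed

text \<open>Zero mutual information forces the product of the marginals to have mass at least 1 on
  the attained pairs, so no pair of positive product mass is left out. This weak form of
  independence is all that the upper bound uses.\<close>

lemma uniform_cond_entropy_eq_entropyD:
  fixes U :: "'a \<Rightarrow> 'b" and V :: "'a \<Rightarrow> 'c" and b :: real
  assumes fin: "finite \<Omega>" and ne: "\<Omega> \<noteq> {}" and b: "b > 1"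
    and eq: "prob_space.conditional_entropy (uniform_count_measure \<Omega>) b
           (count_space (U ` \<Omega>)) (count_space (V ` \<Omega>)) U V =
         prob_space.entropy (uniform_count_measure \<Omega>) b (count_space (U ` \<Omega>)) U"
  shows "(\<lambda>\<omega>. (U \<omega>, V \<omega>)) ` \<Omega> = U ` \<Omega> \<times> V ` \<Omega>"
proof -
  interpret information_space "uniform_count_measure \<Omega>" b
    using fin ne b by (rule uniform_information_space)
  let ?M = "uniform_count_measure \<Omega>"
  let ?W = "\<lambda>\<omega>. (U \<omega>, V \<omega>)"
  have sf: "simple_function ?M X" for X :: "'a \<Rightarrow> 'd"
    by (rule simple_function_uniform_count_measure[OF fin])
  have cO: "card \<Omega> > 0" using fin ne by (simp add: card_gt_0_iff)
  define p where "p = (\<lambda>w. card {\<omega>\<in>\<Omega>. ?W \<omega> = w} / card \<Omega>)"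
  define pU where "pU = (\<lambda>v. card {\<omega>\<in>\<Omega>. U \<omega> = v} / card \<Omega>)"
  define pV where "pV = (\<lambda>v. card {\<omega>\<in>\<Omega>. V \<omega> = v} / card \<Omega>)"
  have U: "simple_distributed ?M U pU"
    unfolding p_def pU_def pV_def by (rule uniform_simple_distributed[OF fin ne])
  have V: "simple_distributed ?M V pV"
    unfolding p_def pU_def pV_def by (rule uniform_simple_distributed[OF fin ne])
  have W: "simple_distributed ?M ?W p"
    unfolding p_def pU_def pV_def by (rule uniform_simple_distributed[OF fin ne])
  have total: "(\<Sum>x\<in>X ` \<Omega>. real (card {\<omega>\<in>\<Omega>. X \<omega> = x}) / card \<Omega>) = 1" for X :: "'a \<Rightarrow> 'd"
  proof -
    have "(\<Sum>x\<in>X ` \<Omega>. card {\<omega>\<in>\<Omega>. X \<omega> = x}) = card \<Omega>"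
      using sum.image_gen[OF fin, of "\<lambda>_. 1::nat" X] by simp
    then show ?thesis
      using cO by (simp add: sum_divide_distrib[symmetric] flip: of_nat_sum)
  qed
  have pos: "0 < p w" "0 < pU (fst w) * pV (snd w)" if "w \<in> ?W ` \<Omega>" for w
    using that cO fin card_fibre_pos[OF fin, of _ ?W] card_fibre_pos[OF fin, of _ U] card_fibre_pos[OF fin, of _ V]
    by (auto simp: p_def pU_def pV_def)
  have posUV: "0 < pU u * pV v" if "u \<in> U ` \<Omega>" "v \<in> V ` \<Omega>" for u v
    using that cO fin card_fibre_pos[OF fin, of _ U] card_fibre_pos[OF fin, of _ V]
    by (auto simp: pU_def pV_def)
  have "mutual_information b (count_space (U ` space ?M)) (count_space (V ` space ?M)) U V = 0"
    using mutual_information_eq_entropy_conditional_entropy[OF sf sf, of U V] eq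
    by (simp add: space_uniform_count_measure)
  then have "(\<Sum>w\<in>?W ` \<Omega>. p w * log b (p w / (pU (fst w) * pV (snd w)))) = 0"
    unfolding mutual_information_simple_distributed[OF U V W]
    by (simp add: space_uniform_count_measure split_beta)
  \<comment> \<open>Gibbs: \<open>ln x \<le> x - 1\<close> turns vanishing mutual information into the statement that the product
    distribution is supported on the image of the pair.\<close>
  then have 0: "(\<Sum>w\<in>?W ` \<Omega>. p w * ln (p w / (pU (fst w) * pV (snd w)))) = 0"
    using b by (simp add: log_def sum_divide_distrib[symmetric])
  have "(\<Sum>w\<in>?W ` \<Omega>. p w - pU (fst w) * pV (snd w)) \<le>
      (\<Sum>w\<in>?W ` \<Omega>. p w * ln (p w / (pU (fst w) * pV (snd w))))"
  proof (rule sum_mono)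
    fix w assume w: "w \<in> ?W ` \<Omega>"
    have "ln (pU (fst w) * pV (snd w) / p w) \<le> pU (fst w) * pV (snd w) / p w - 1"
      using pos[OF w] by (intro ln_le_minus_one) auto
    then have "p w * ln (pU (fst w) * pV (snd w) / p w) \<le> 
        p w * (pU (fst w) * pV (snd w) / p w - 1)"
      using pos[OF w] by (intro mult_left_mono) auto
    then show "p w - pU (fst w) * pV (snd w) \<le> p w * ln (p w / (pU (fst w) * pV (snd w)))"
      using pos[OF w] by (simp add: ln_divide_pos algebra_simps)
  qed
  then have "(\<Sum>w\<in>?W ` \<Omega>. p w) \<le> (\<Sum>w\<in>?W ` \<Omega>. pU (fst w) * pV (snd w))"
    using 0 by (simp add: sum_subtractf)
  then have ge: "1 \<le> (\<Sum>w\<in>?W ` \<Omega>. pU (fst w) * pV (snd w))"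
    using total[of ?W] by (simp add: p_def)
  have prod: "(\<Sum>w\<in>U ` \<Omega> \<times> V ` \<Omega>. pU (fst w) * pV (snd w)) = 1"
  proof -
    have "(\<Sum>w\<in>U ` \<Omega> \<times> V ` \<Omega>. pU (fst w) * pV (snd w)) = sum pU (U ` \<Omega>) * sum pV (V ` \<Omega>)"
      by (simp add: sum_product sum.cartesian_product split_beta)
    then show ?thesis
      using total[of U] total[of V] by (simp add: pU_def pV_def)
  qed
  show ?thesis
  proof (rule ccontr)
    \<comment> \<open>An unattained pair \<open>w\<close> carries positive product mass, so the
      attained pairs would have mass strictly below 1.\<close>
    assume "?W ` \<Omega> \<noteq> U ` \<Omega> \<times> V ` \<Omega>"
    then obtain w where w: "w \<in> U ` \<Omega> \<times> V ` \<Omega>" "w \<notin> ?W ` \<Omega>" by auto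
    have "(\<Sum>w\<in>?W ` \<Omega>. pU (fst w) * pV (snd w)) < (\<Sum>w\<in>U ` \<Omega> \<times> V ` \<Omega>. pU (fst w) * pV (snd w))"
      using fin w posUV by (intro sum_strict_mono2[where b=w]) (auto intro: less_imp_le)
    with ge prod show False by simp
  qed
qed

text \<open>Injections that preserve \<open>V\<close> exist between any two fibres of
  \<open>U\<close> in both directions. Hence all fibres of \<open>U\<close> meet a given fibre of
  \<open>V\<close> equally often, which is independence.\<close>

lemma uniform_cond_entropy_eq_entropy_transferI:
  fixes U :: "'a \<Rightarrow> 'b" and V :: "'a \<Rightarrow> 'c" and b :: real
  assumes fin: "finite \<Omega>" and ne: "\<Omega> \<noteq> {}" and b: "b > 1"
    and transfer: "\<And>u u'. u \<in> U ` \<Omega> \<Longrightarrow> u' \<in> U ` \<Omega> \<Longrightarrow> \<exists>T. inj_on T {\<omega>\<in>\<Omega>. U \<omega> = u} \<and>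
      (\<forall>\<omega>\<in>\<Omega>. U \<omega> = u \<longrightarrow> T \<omega> \<in> \<Omega> \<and> U (T \<omega>) = u' \<and> V (T \<omega>) = V \<omega>)"
  shows "prob_space.conditional_entropy (uniform_count_measure \<Omega>) b
           (count_space (U ` \<Omega>)) (count_space (V ` \<Omega>)) U V =
         prob_space.entropy (uniform_count_measure \<Omega>) b (count_space (U ` \<Omega>)) U"
proof (rule uniform_cond_entropy_eq_entropyI[OF fin ne b])
  fix u v assume u: "u \<in> U ` \<Omega>"
  \<comment> \<open>\<open>P\<close> stays free because it is needed twice at the end: the constant
    \<open>True\<close> counts the fibres of \<open>U\<close>, and equality with \<open>v\<close>
    counts the joint fibres.\<close>
  have le: "card {\<omega>\<in>\<Omega>. U \<omega> = u \<and> P (V \<omega>)} \<le> card {\<omega>\<in>\<Omega>. U \<omega> = u' \<and> P (V \<omega>)}"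
    if uu: "u \<in> U ` \<Omega>" "u' \<in> U ` \<Omega>" for u u' P
  proof -
    obtain T where inj: "inj_on T {\<omega>\<in>\<Omega>. U \<omega> = u}"
      and T: "\<And>\<omega>. \<omega> \<in> \<Omega> \<Longrightarrow> U \<omega> = u \<Longrightarrow> T \<omega> \<in> \<Omega> \<and> U (T \<omega>) = u' \<and> V (T \<omega>) = V \<omega>"
      using transfer[OF uu] by blast
    have "inj_on T {\<omega>\<in>\<Omega>. U \<omega> = u \<and> P (V \<omega>)}"
      by (rule inj_on_subset[OF inj]) auto
    then show ?thesis
      using T fin by (intro card_inj_on_le) auto
  qed
  have sum: "card {\<omega>\<in>\<Omega>. P (V \<omega>)} = card (U ` \<Omega>) * card {\<omega>\<in>\<Omega>. U \<omega> = u \<and> P (V \<omega>)}" for P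
  proof -
    have "{\<omega>\<in>\<Omega>. P (V \<omega>)} = (\<Union>u'\<in>U ` \<Omega>. {\<omega>\<in>\<Omega>. U \<omega> = u' \<and> P (V \<omega>)})" by auto
    also have "card \<dots> = (\<Sum>u'\<in>U ` \<Omega>. card {\<omega>\<in>\<Omega>. U \<omega> = u' \<and> P (V \<omega>)})"
      using fin by (intro card_UN_disjoint) auto
    also have "\<dots> = (\<Sum>u'\<in>U ` \<Omega>. card {\<omega>\<in>\<Omega>. U \<omega> = u \<and> P (V \<omega>)})"
      using le u by (intro sum.cong refl antisym) auto
    finally show ?thesis by simp
  qed
  show "card {\<omega>\<in>\<Omega>. U \<omega> = u \<and> V \<omega> = v} * card \<Omega> =
      card {\<omega>\<in>\<Omega>. U \<omega> = u} * card {\<omega>\<in>\<Omega>. V \<omega> = v}"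
    using sum[of "\<lambda>_. True"] sum[of "\<lambda>x. x = v"] by simp
qed

subsection \<open>Schemes as families of linear functionals\<close>

definition outcomes :: "linear_scheme \<Rightarrow> ((nat \<Rightarrow> nat) \<times> (nat \<Rightarrow> nat)) set" where
  "outcomes \<sigma> = vectors (base_field \<sigma>) (secret_len \<sigma>) \<times> vectors (base_field \<sigma>) (noise_len \<sigma>)"

lemma scheme_space_outcomes: "scheme_space \<sigma> = uniform_count_measure (outcomes \<sigma>)"
  by (simp add: scheme_space_def outcomes_def)

lemma card_vectors: "card (vectors K n) = card (carrier K) ^ n"
  by (simp add: vectors_def card_PiE)

lemma finite_vectors: "finite (carrier K) \<Longrightarrow> finite (vectors K n)"
  by (simp add: vectors_def finite_PiE)

lemma vectors_nonempty: "carrier K \<noteq> {} \<Longrightarrow> vectors K n \<noteq> {}"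
  by (auto simp: vectors_def PiE_eq_empty_iff)

lemma vectors_memD: "x \<in> vectors K n \<Longrightarrow> i < n \<Longrightarrow> x i \<in> carrier K"
  by (auto simp: vectors_def)

lemma vectors_eqI: "x \<in> vectors K n \<Longrightarrow> y \<in> vectors K n \<Longrightarrow> (\<And>i. i < n \<Longrightarrow> x i = y i) \<Longrightarrow> x = y"
  unfolding vectors_def by (rule PiE_ext) auto

lemma (in field) card_carrier_gt_1: "finite (carrier R) \<Longrightarrow> card (carrier R) > 1"
proof -
  assume fin: "finite (carrier R)"
  have "card {\<zero>, \<one>} \<le> card (carrier R)"
    using fin by (intro card_mono) auto
  then show ?thesis by simp
qed

lemma finite_outcomes: "finite (carrier (base_field \<sigma>)) \<Longrightarrow> finite (outcomes \<sigma>)"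
  by (simp add: outcomes_def finite_vectors)

lemma outcomes_nonempty: "field (base_field \<sigma>) \<Longrightarrow> outcomes \<sigma> \<noteq> {}"
proof -
  assume "field (base_field \<sigma>)"
  then interpret field "base_field \<sigma>" .
  have "carrier (base_field \<sigma>) \<noteq> {}" using zero_closed by blast
  then show ?thesis by (simp add: outcomes_def vectors_nonempty)
qed

lemma decodable_iff:
  assumes "field (base_field \<sigma>)" "finite (carrier (base_field \<sigma>))"
  shows "shannon_cond_entropy \<sigma> secret V = 0 \<longleftrightarrow>
    (\<forall>\<omega>\<in>outcomes \<sigma>. \<forall>\<omega>'\<in>outcomes \<sigma>. V \<omega> = V \<omega>' \<longrightarrow> secret \<omega> = secret \<omega>')"
proof -
  have "real (card (carrier (base_field \<sigma>))) > 1"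
    using field.card_carrier_gt_1[OF assms] by simp
  then show ?thesis
    using uniform_cond_entropy_eq_0_iff[OF finite_outcomes[OF assms(2)] outcomes_nonempty[OF assms(1)],
        of _ secret V]
    by (simp add: shannon_cond_entropy_def scheme_space_outcomes space_uniform_count_measure)
qed

text \<open>Security is used by replacement: the secret of an outcome can be exchanged for any other
  possible secret without changing the value of \<open>V\<close>.\<close>

lemma secureD:
  assumes "field (base_field \<sigma>)" "finite (carrier (base_field \<sigma>))"
    and "shannon_cond_entropy \<sigma> secret V = shannon_entropy \<sigma> secret"
    and "\<omega> \<in> outcomes \<sigma>" "\<omega>' \<in> outcomes \<sigma>"
  obtains \<omega>'' where "\<omega>'' \<in> outcomes \<sigma>" "secret \<omega>'' = secret \<omega>" "V \<omega>'' = V \<omega>'"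
proof -
  have "(\<lambda>\<omega>. (secret \<omega>, V \<omega>)) ` outcomes \<sigma> = secret ` outcomes \<sigma> \<times> V ` outcomes \<sigma>"
    using assms field.card_carrier_gt_1[OF assms(1,2)]
    by (intro uniform_cond_entropy_eq_entropyD[where b="real (card (carrier (base_field \<sigma>)))"])
      (simp_all add: finite_outcomes outcomes_nonempty shannon_cond_entropy_def shannon_entropy_def
         scheme_space_outcomes space_uniform_count_measure)
  moreover have "(secret \<omega>, V \<omega>') \<in> secret ` outcomes \<sigma> \<times> V ` outcomes \<sigma>"
    using assms by auto
  ultimately have "(secret \<omega>, V \<omega>') \<in> (\<lambda>\<omega>. (secret \<omega>, V \<omega>)) ` outcomes \<sigma>"
    by simp
  then show ?thesis using that by auto
qed

text \<open>
  Linearity is expressed relative to a bare operation \<open>comb x c y\<close>, to be thought of as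
  \<open>x + c y\<close>; no other vector space structure is needed for duality.
\<close>

definition linear_functional ::
  "('a, 'm) ring_scheme \<Rightarrow> 'b set \<Rightarrow> ('b \<Rightarrow> 'a \<Rightarrow> 'b \<Rightarrow> 'b) \<Rightarrow> ('b \<Rightarrow> 'a) \<Rightarrow> bool" where
  "linear_functional K \<Omega> comb \<phi> \<longleftrightarrow> \<phi> \<in> \<Omega> \<rightarrow> carrier K \<and>
     (\<forall>x\<in>\<Omega>. \<forall>c\<in>carrier K. \<forall>y\<in>\<Omega>. \<phi> (comb x c y) = \<phi> x \<oplus>\<^bsub>K\<^esub> c \<otimes>\<^bsub>K\<^esub> \<phi> y)"

lemma (in field) linear_functional_minus_multiple:
  assumes "linear_functional R \<Omega> comb \<phi>" "linear_functional R \<Omega> comb \<psi>" "a \<in> carrier R"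
  shows "linear_functional R \<Omega> comb (\<lambda>x. \<phi> x \<ominus> a \<otimes> \<psi> x)"
  unfolding linear_functional_def
proof (intro conjI ballI)
  show "(\<lambda>x. \<phi> x \<ominus> a \<otimes> \<psi> x) \<in> \<Omega> \<rightarrow> carrier R"
    using assms by (force simp: linear_functional_def)
  fix x c y assume *: "x \<in> \<Omega>" "c \<in> carrier R" "y \<in> \<Omega>"
  then have cl: "\<phi> x \<in> carrier R" "\<phi> y \<in> carrier R" "\<psi> x \<in> carrier R" "\<psi> y \<in> carrier R"
    using assms by (auto simp: linear_functional_def)
  have eq: "\<phi> (comb x c y) = \<phi> x \<oplus> c \<otimes> \<phi> y" "\<psi> (comb x c y) = \<psi> x \<oplus> c \<otimes> \<psi> y"
    using assms * by (auto simp: linear_functional_def)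
  show "\<phi> (comb x c y) \<ominus> a \<otimes> \<psi> (comb x c y) = \<phi> x \<ominus> a \<otimes> \<psi> x \<oplus> c \<otimes> (\<phi> y \<ominus> a \<otimes> \<psi> y)"
    unfolding eq using cl * assms(3) by algebra
qed

text \<open>Duality by induction on \<open>m\<close>: subtracting a suitable multiple of
  \<open>r m\<close> from \<open>e\<close> gives a functional that vanishes on the common kernel of
  the earlier \<open>r i\<close>, to which the induction hypothesis applies. For this
  \<open>e\<close> must be arbitrary in the induction.\<close>

lemma (in field) functional_in_span:
  assumes comb: "\<And>x c y. x \<in> \<Omega> \<Longrightarrow> c \<in> carrier R \<Longrightarrow> y \<in> \<Omega> \<Longrightarrow> comb x c y \<in> \<Omega>"
    and r: "\<And>i. i < (m::nat) \<Longrightarrow> linear_functional R \<Omega> comb (r i)"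
    and e: "linear_functional R \<Omega> comb e"
    and ker: "\<And>x. x \<in> \<Omega> \<Longrightarrow> (\<And>i. i < m \<Longrightarrow> r i x = \<zero>) \<Longrightarrow> e x = \<zero>"
  shows "\<exists>c\<in>{..<m} \<rightarrow>\<^sub>E carrier R. \<forall>x\<in>\<Omega>. e x = (\<Oplus>i\<in>{..<m}. c i \<otimes> r i x)"
  using r e ker
proof (induction m arbitrary: e)
  case 0
  then show ?case by auto
next
  case (Suc m)
  have rc: "r i x \<in> carrier R" if "i < Suc m" "x \<in> \<Omega>" for i x
    using Suc.prems(1)[OF that(1)] that by (auto simp: linear_functional_def)
  have ec: "e x \<in> carrier R" if "x \<in> \<Omega>" for x
    using Suc.prems(2) that by (auto simp: linear_functional_def)
  \<comment> \<open>If \<open>r m\<close> vanishes on the common kernel of the earlier functionals,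
    \<open>a\<close> is zero. Otherwise \<open>a\<close> is the quotient of \<open>e x0\<close> by
    \<open>r m x0\<close>, for a point \<open>x0\<close> of that kernel with \<open>r m x0\<close>
    nonzero.\<close>
  have "\<exists>a\<in>carrier R. \<forall>x\<in>\<Omega>. (\<forall>i<m. r i x = \<zero>) \<longrightarrow> e x \<ominus> a \<otimes> r m x = \<zero>"
  proof (cases "\<exists>x0\<in>\<Omega>. (\<forall>i<m. r i x0 = \<zero>) \<and> r m x0 \<noteq> \<zero>")
    case False
    then have "e x \<ominus> \<zero> \<otimes> r m x = \<zero>" if "x \<in> \<Omega>" "\<forall>i<m. r i x = \<zero>" for x
      using that Suc.prems(3)[of x] ec[of x] rc[of m x] by (simp add: less_Suc_eq a_minus_def) blast
    then show ?thesis by blast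
  next
    case True
    then obtain x0 where x0: "x0 \<in> \<Omega>" "\<And>i. i < m \<Longrightarrow> r i x0 = \<zero>" "r m x0 \<noteq> \<zero>" by blast
    define u where "u = inv (r m x0)"
    have u: "u \<in> carrier R" "r m x0 \<otimes> u = \<one>"
      using x0 rc[of m x0] by (auto simp: u_def field_Units)
    have "e x \<ominus> (e x0 \<otimes> u) \<otimes> r m x = \<zero>" if x: "x \<in> \<Omega>" "\<forall>i<m. r i x = \<zero>" for x
    proof -
      \<comment> \<open>This scalar moves \<open>x\<close> along \<open>x0\<close> into the kernel
        of \<open>r m\<close>, without leaving the kernels of the earlier
        \<open>r i\<close>.\<close>
      define c where "c = \<ominus> (r m x \<otimes> u)"
      have c: "c \<in> carrier R" using u rc[of m x] x by (simp add: c_def)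
      have lin: "r i (comb x c x0) = r i x \<oplus> c \<otimes> r i x0" if "i < Suc m" for i
        using Suc.prems(1)[OF that] x(1) c x0(1) by (simp add: linear_functional_def)
      have "e (comb x c x0) = \<zero>"
      proof (rule Suc.prems(3))
        show "comb x c x0 \<in> \<Omega>" using comb x c x0 by blast
        fix i assume i: "i < Suc m"
        show "r i (comb x c x0) = \<zero>"
        proof (cases "i = m")
          case True
          have "r m x \<oplus> \<ominus> (r m x \<otimes> u) \<otimes> r m x0 = r m x \<ominus> r m x \<otimes> (r m x0 \<otimes> u)"
            using rc[OF lessI x(1)] rc[OF lessI x0(1)] u(1) by algebra
          also have "\<dots> = \<zero>"
            using rc[of m x] x u by (simp add: a_minus_def r_neg)
          finally show ?thesis using lin[OF i] True by (simp add: c_def)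
        next
          case False
          then show ?thesis using lin[OF i] i x x0 c by (simp add: less_Suc_eq)
        qed
      qed
      moreover have "e (comb x c x0) = e x \<oplus> c \<otimes> e x0"
        using Suc.prems(2) x(1) c x0(1) by (simp add: linear_functional_def)
      moreover have "e x \<oplus> c \<otimes> e x0 = e x \<ominus> (e x0 \<otimes> u) \<otimes> r m x"
        unfolding c_def using ec[OF x(1)] ec[OF x0(1)] rc[OF lessI x(1)] u(1) by algebra
      ultimately show ?thesis by simp
    qed
    then show ?thesis using u ec[of x0] x0 by blast
  qed
  then obtain a where a: "a \<in> carrier R"
    and ker': "\<And>x. x \<in> \<Omega> \<Longrightarrow> (\<And>i. i < m \<Longrightarrow> r i x = \<zero>) \<Longrightarrow> e x \<ominus> a \<otimes> r m x = \<zero>" by blast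
  have "\<exists>c\<in>{..<m} \<rightarrow>\<^sub>E carrier R. \<forall>x\<in>\<Omega>. e x \<ominus> a \<otimes> r m x = (\<Oplus>i\<in>{..<m}. c i \<otimes> r i x)"
    using Suc.prems(1,2) a ker'
    by (intro Suc.IH linear_functional_minus_multiple) auto
  then obtain c where c: "c \<in> {..<m} \<rightarrow>\<^sub>E carrier R"
    and c_eq: "\<And>x. x \<in> \<Omega> \<Longrightarrow> e x \<ominus> a \<otimes> r m x = (\<Oplus>i\<in>{..<m}. c i \<otimes> r i x)" by blast
  have cc: "c i \<in> carrier R" if "i < m" for i using c that by auto
  have "e x = (\<Oplus>i\<in>{..<Suc m}. (c(m := a)) i \<otimes> r i x)" if x: "x \<in> \<Omega>" for x
  proof -
    have "(\<Oplus>i\<in>{..<Suc m}. (c(m := a)) i \<otimes> r i x) =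
        a \<otimes> r m x \<oplus> (\<Oplus>i\<in>{..<m}. (c(m := a)) i \<otimes> r i x)"
      unfolding lessThan_Suc
      using cc a rc[OF _ x] by (subst finsum_insert) auto
    also have "(\<Oplus>i\<in>{..<m}. (c(m := a)) i \<otimes> r i x) = (\<Oplus>i\<in>{..<m}. c i \<otimes> r i x)"
      using cc rc[OF _ x] by (intro finsum_cong') auto
    also have "\<dots> = e x \<ominus> a \<otimes> r m x" using c_eq[OF x] by simp
    also have "a \<otimes> r m x \<oplus> (e x \<ominus> a \<otimes> r m x) = e x"
      using a rc[OF lessI x] ec[OF x] by algebra
    finally show ?thesis by simp
  qed
  moreover have "c(m := a) \<in> {..<Suc m} \<rightarrow>\<^sub>E carrier R"
    using c a by (auto simp: PiE_def extensional_def Pi_def less_Suc_eq)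
  ultimately show ?case by blast
qed

section \<open>Dot products and linear combinations of vectors\<close>

definition dot :: "('a, 'm) ring_scheme \<Rightarrow> nat \<Rightarrow> (nat \<Rightarrow> 'a) \<Rightarrow> (nat \<Rightarrow> 'a) \<Rightarrow> 'a" where
  "dot K n a x = (\<Oplus>\<^bsub>K\<^esub>i\<in>{..<n}. a i \<otimes>\<^bsub>K\<^esub> x i)"

definition vec_comb :: "nat ring \<Rightarrow> nat \<Rightarrow> (nat \<Rightarrow> nat) \<Rightarrow> nat \<Rightarrow> (nat \<Rightarrow> nat) \<Rightarrow> nat \<Rightarrow> nat" where
  "vec_comb K n x c y = (\<lambda>i\<in>{..<n}. x i \<oplus>\<^bsub>K\<^esub> c \<otimes>\<^bsub>K\<^esub> y i)"

definition outcome_comb where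
  "outcome_comb \<sigma> \<omega> c \<omega>' =
     (vec_comb (base_field \<sigma>) (secret_len \<sigma>) (fst \<omega>) c (fst \<omega>'),
      vec_comb (base_field \<sigma>) (noise_len \<sigma>) (snd \<omega>) c (snd \<omega>'))"

lemma (in cring) dot_closed:
  "(\<And>i. i < n \<Longrightarrow> a i \<in> carrier R) \<Longrightarrow> (\<And>i. i < n \<Longrightarrow> x i \<in> carrier R) \<Longrightarrow> dot R n a x \<in> carrier R"
  unfolding dot_def by (intro finsum_closed) auto

lemma (in cring) dot_zero_right:
  "(\<And>i. i < n \<Longrightarrow> a i \<in> carrier R) \<Longrightarrow> (\<And>i. i < n \<Longrightarrow> x i = \<zero>) \<Longrightarrow> dot R n a x = \<zero>"
  unfolding dot_def by (intro add.finprod_one_eqI) auto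

lemma (in cring) dot_add_left:
  assumes "\<And>i. i < n \<Longrightarrow> a i \<in> carrier R" "\<And>i. i < n \<Longrightarrow> b i \<in> carrier R"
    "\<And>i. i < n \<Longrightarrow> x i \<in> carrier R"
  shows "dot R n (\<lambda>i\<in>{..<n}. a i \<oplus> b i) x = dot R n a x \<oplus> dot R n b x"
proof -
  have "dot R n (\<lambda>i\<in>{..<n}. a i \<oplus> b i) x = (\<Oplus>i\<in>{..<n}. a i \<otimes> x i \<oplus> b i \<otimes> x i)"
    unfolding dot_def using assms by (intro finsum_cong') (auto simp: l_distr)
  also have "\<dots> = dot R n a x \<oplus> dot R n b x"
    unfolding dot_def using assms by (intro finsum_addf) auto
  finally show ?thesis .
qed

lemma (in cring) dot_comb_right:
  assumes "\<And>i. i < n \<Longrightarrow> a i \<in> carrier R" "\<And>i. i < n \<Longrightarrow> x i \<in> carrier R"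
    "\<And>i. i < n \<Longrightarrow> y i \<in> carrier R" "c \<in> carrier R"
  shows "dot R n a (\<lambda>i\<in>{..<n}. x i \<oplus> c \<otimes> y i) = dot R n a x \<oplus> c \<otimes> dot R n a y"
proof -
  have "dot R n a (\<lambda>i\<in>{..<n}. x i \<oplus> c \<otimes> y i) = (\<Oplus>i\<in>{..<n}. a i \<otimes> x i \<oplus> c \<otimes> (a i \<otimes> y i))"
    unfolding dot_def using assms by (intro finsum_cong') (auto simp: r_distr m_lcomm)
  also have "\<dots> = dot R n a x \<oplus> (\<Oplus>i\<in>{..<n}. c \<otimes> (a i \<otimes> y i))"
    unfolding dot_def using assms by (intro finsum_addf) auto
  also have "(\<Oplus>i\<in>{..<n}. c \<otimes> (a i \<otimes> y i)) = c \<otimes> dot R n a y"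
    unfolding dot_def using assms by (intro finsum_rdistr[symmetric]) auto
  finally show ?thesis .
qed

lemma (in cring) dot_unit:
  assumes "\<And>i. i < n \<Longrightarrow> a i \<in> carrier R" "j < n"
  shows "dot R n a (\<lambda>i\<in>{..<n}. if i = j then \<one> else \<zero>) = a j"
proof -
  have "dot R n a (\<lambda>i\<in>{..<n}. if i = j then \<one> else \<zero>) =
      (\<Oplus>i\<in>{..<n}. if j = i then a i else \<zero>)"
    unfolding dot_def using assms by (intro finsum_cong') auto
  also have "\<dots> = a j"
    using assms by (intro finsum_singleton) auto
  finally show ?thesis .
qed

text \<open>Splitting the sum at \<open>m\<close> allows the coordinates of two signals to be
  treated as one concatenated family of functionals.\<close>

lemma (in cring) dot_append:
  assumes "\<And>i. i < m + n \<Longrightarrow> a i \<in> carrier R" "\<And>i. i < m \<Longrightarrow> x i \<in> carrier R"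
    "\<And>i. i < n \<Longrightarrow> y i \<in> carrier R"
  shows "dot R (m + n) a (\<lambda>i. if i < m then x i else y (i - m)) =
    dot R m a x \<oplus> dot R n (\<lambda>i. a (m + i)) y"
  using assms
proof (induction n)
  case 0
  have "dot R m a (\<lambda>i. if i < m then x i else y (i - m)) = dot R m a x"
    unfolding dot_def using 0 by (intro finsum_cong') auto
  then show ?case
    using 0 by (simp add: dot_closed) (simp add: dot_def)
next
  case (Suc n)
  have cl: "a i \<in> carrier R" "i < m \<Longrightarrow> x i \<in> carrier R" if "i < m + Suc n" for i
    using Suc.prems that by auto
  have cly: "y i \<in> carrier R" if "i \<le> n" for i using Suc.prems that by auto
  have "dot R (m + Suc n) a (\<lambda>i. if i < m then x i else y (i - m)) =
      a (m + n) \<otimes> y n \<oplus> dot R (m + n) a (\<lambda>i. if i < m then x i else y (i - m))"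
    unfolding dot_def add_Suc_right lessThan_Suc
    using cl cly by (subst finsum_insert) auto
  also have "dot R (m + n) a (\<lambda>i. if i < m then x i else y (i - m)) =
      dot R m a x \<oplus> dot R n (\<lambda>i. a (m + i)) y"
    using Suc by simp
  also have "a (m + n) \<otimes> y n \<oplus> (dot R m a x \<oplus> dot R n (\<lambda>i. a (m + i)) y) =
      dot R m a x \<oplus> (a (m + n) \<otimes> y n \<oplus> dot R n (\<lambda>i. a (m + i)) y)"
    using cl cly by (intro a_lcomm dot_closed m_closed) auto
  also have "a (m + n) \<otimes> y n \<oplus> dot R n (\<lambda>i. a (m + i)) y = dot R (Suc n) (\<lambda>i. a (m + i)) y"
    unfolding dot_def lessThan_Suc
    using cl cly by (subst finsum_insert) auto
  finally show ?case .
qed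

section \<open>Signal coordinates as linear functionals of the outcome\<close>

lemma outcome_comb_closed:
  assumes "cring (base_field \<sigma>)" "\<omega> \<in> outcomes \<sigma>" "c \<in> carrier (base_field \<sigma>)" "\<omega>' \<in> outcomes \<sigma>"
  shows "outcome_comb \<sigma> \<omega> c \<omega>' \<in> outcomes \<sigma>"
proof -
  interpret cring "base_field \<sigma>" by fact
  have "vec_comb (base_field \<sigma>) n x c y \<in> vectors (base_field \<sigma>) n"
    if "x \<in> vectors (base_field \<sigma>) n" "y \<in> vectors (base_field \<sigma>) n" for n x y
    using vectors_memD[OF that(1)] vectors_memD[OF that(2)] assms(3)
    by (auto simp: vec_comb_def vectors_def)
  then show ?thesis
    using assms by (auto simp: outcome_comb_def outcomes_def)
qed

lemma signal_value_dot:
  "i < signal_len \<sigma> \<Longrightarrow> signal_value \<sigma> v \<omega> i =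
     dot (base_field \<sigma>) (secret_len \<sigma>) (secret_mat \<sigma> v i) (secret \<omega>) \<oplus>\<^bsub>base_field \<sigma>\<^esub>
     dot (base_field \<sigma>) (noise_len \<sigma>) (noise_mat \<sigma> v i) (noise \<omega>)"
  by (simp add: signal_value_def dot_def Let_def)

lemma outcomesD:
  assumes "\<omega> \<in> outcomes \<sigma>"
  shows "secret \<omega> \<in> vectors (base_field \<sigma>) (secret_len \<sigma>)"
    "noise \<omega> \<in> vectors (base_field \<sigma>) (noise_len \<sigma>)"
  using assms by (auto simp: outcomes_def secret_def noise_def)

lemma linear_functional_secret:
  assumes "cring (base_field \<sigma>)" "t \<in> vectors (base_field \<sigma>) (secret_len \<sigma>)"
  shows "linear_functional (base_field \<sigma>) (outcomes \<sigma>) (outcome_comb \<sigma>)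
    (\<lambda>\<omega>. dot (base_field \<sigma>) (secret_len \<sigma>) t (secret \<omega>))"
proof -
  interpret cring "base_field \<sigma>" by fact
  show ?thesis
    unfolding linear_functional_def
    using assms
    by (auto simp: outcome_comb_def vec_comb_def secret_def outcomes_def
        vectors_memD[where K="base_field \<sigma>"] intro!: dot_closed dot_comb_right)
qed

lemma linear_functional_signal:
  assumes "cring (base_field \<sigma>)" "i < signal_len \<sigma>"
    and F: "is_matrix (base_field \<sigma>) (signal_len \<sigma>) (secret_len \<sigma>) (secret_mat \<sigma> v)"
    and H: "is_matrix (base_field \<sigma>) (signal_len \<sigma>) (noise_len \<sigma>) (noise_mat \<sigma> v)"
  shows "linear_functional (base_field \<sigma>) (outcomes \<sigma>) (outcome_comb \<sigma>)
    (\<lambda>\<omega>. signal_value \<sigma> v \<omega> i)"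
proof -
  interpret cring "base_field \<sigma>" by fact
  let ?F = "dot (base_field \<sigma>) (secret_len \<sigma>) (secret_mat \<sigma> v i)"
  let ?H = "dot (base_field \<sigma>) (noise_len \<sigma>) (noise_mat \<sigma> v i)"
  have F': "secret_mat \<sigma> v i j \<in> carrier (base_field \<sigma>)" if "j < secret_len \<sigma>" for j
    using F that assms(2) by (simp add: is_matrix_def)
  have H': "noise_mat \<sigma> v i j \<in> carrier (base_field \<sigma>)" if "j < noise_len \<sigma>" for j
    using H that assms(2) by (simp add: is_matrix_def)
  have cl: "?F (secret \<omega>) \<in> carrier (base_field \<sigma>)" "?H (noise \<omega>) \<in> carrier (base_field \<sigma>)"
    if "\<omega> \<in> outcomes \<sigma>" for \<omega>
    using outcomesD[OF that] F' H' by (auto simp: vectors_memD[where K="base_field \<sigma>"] intro!: dot_closed)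
  show ?thesis
    unfolding linear_functional_def signal_value_dot[OF assms(2)]
  proof (intro conjI ballI funcsetI)
    fix x assume x: "x \<in> outcomes \<sigma>"
    show "?F (secret x) \<oplus>\<^bsub>base_field \<sigma>\<^esub> ?H (noise x) \<in> carrier (base_field \<sigma>)"
      using cl[OF x] by simp
    fix c y assume c: "c \<in> carrier (base_field \<sigma>)" and y: "y \<in> outcomes \<sigma>"
    have "?F (secret (outcome_comb \<sigma> x c y)) =
        ?F (secret x) \<oplus>\<^bsub>base_field \<sigma>\<^esub> c \<otimes>\<^bsub>base_field \<sigma>\<^esub> ?F (secret y)"
      using outcomesD[OF x] outcomesD[OF y] c F'
      by (simp add: outcome_comb_def vec_comb_def secret_def dot_comb_right vectors_memD)
    moreover have "?H (noise (outcome_comb \<sigma> x c y)) =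
        ?H (noise x) \<oplus>\<^bsub>base_field \<sigma>\<^esub> c \<otimes>\<^bsub>base_field \<sigma>\<^esub> ?H (noise y)"
      using outcomesD[OF x] outcomesD[OF y] c H'
      by (simp add: outcome_comb_def vec_comb_def noise_def dot_comb_right vectors_memD)
    ultimately show "?F (secret (outcome_comb \<sigma> x c y)) \<oplus>\<^bsub>base_field \<sigma>\<^esub>
        ?H (noise (outcome_comb \<sigma> x c y)) =
        (?F (secret x) \<oplus>\<^bsub>base_field \<sigma>\<^esub> ?H (noise x)) \<oplus>\<^bsub>base_field \<sigma>\<^esub>
        c \<otimes>\<^bsub>base_field \<sigma>\<^esub> (?F (secret y) \<oplus>\<^bsub>base_field \<sigma>\<^esub> ?H (noise y))"
      using cl[OF x] cl[OF y] c by (simp add: r_distr a_ac)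
  qed
qed

definition zero_outcome :: "linear_scheme \<Rightarrow> (nat \<Rightarrow> nat) \<times> (nat \<Rightarrow> nat)" where
  "zero_outcome \<sigma> = (\<lambda>j\<in>{..<secret_len \<sigma>}. \<zero>\<^bsub>base_field \<sigma>\<^esub>, \<lambda>j\<in>{..<noise_len \<sigma>}. \<zero>\<^bsub>base_field \<sigma>\<^esub>)"

lemma zero_outcome_closed: "cring (base_field \<sigma>) \<Longrightarrow> zero_outcome \<sigma> \<in> outcomes \<sigma>"
proof -
  assume "cring (base_field \<sigma>)"
  then interpret cring "base_field \<sigma>" .
  show ?thesis by (auto simp: zero_outcome_def outcomes_def vectors_def)
qed

lemma signal_zero_outcome:
  assumes "cring (base_field \<sigma>)" "i < signal_len \<sigma>"
    and F: "is_matrix (base_field \<sigma>) (signal_len \<sigma>) (secret_len \<sigma>) (secret_mat \<sigma> v)"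
    and H: "is_matrix (base_field \<sigma>) (signal_len \<sigma>) (noise_len \<sigma>) (noise_mat \<sigma> v)"
  shows "signal_value \<sigma> v (zero_outcome \<sigma>) i = \<zero>\<^bsub>base_field \<sigma>\<^esub>"
proof -
  interpret cring "base_field \<sigma>" by fact
  show ?thesis
    using assms
    by (simp add: signal_value_dot zero_outcome_def secret_def noise_def dot_zero_right is_matrix_def)
qed

lemma signal_value_closed:
  assumes "cring (base_field \<sigma>)"
    and "is_matrix (base_field \<sigma>) (signal_len \<sigma>) (secret_len \<sigma>) (secret_mat \<sigma> v)"
    and "is_matrix (base_field \<sigma>) (signal_len \<sigma>) (noise_len \<sigma>) (noise_mat \<sigma> v)"
    and "\<omega> \<in> outcomes \<sigma>"
  shows "signal_value \<sigma> v \<omega> \<in> vectors (base_field \<sigma>) (signal_len \<sigma>)"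
proof -
  have "signal_value \<sigma> v \<omega> i \<in> carrier (base_field \<sigma>)" if "i < signal_len \<sigma>" for i
    using linear_functional_signal[OF assms(1) that assms(2,3)] assms(4)
    by (auto simp: linear_functional_def)
  then show ?thesis
    by (auto simp: vectors_def PiE_def extensional_def signal_value_def Let_def)
qed

text \<open>Where both signals vanish, the view is that of \<open>zero_outcome\<close>, so by
  decodability the secret is zero. Hence the dot product of \<open>t\<close> with the secret
  vanishes on the common kernel of the \<open>N + N\<close> signal coordinates, and
  \<open>functional_in_span\<close> writes it as a combination of them.\<close>

lemma decoding_coefficients:
  fixes \<sigma> :: linear_scheme
  defines "K \<equiv> base_field \<sigma>" and "L \<equiv> secret_len \<sigma>" and "N \<equiv> signal_len \<sigma>"
  assumes "field K" "finite (carrier K)"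
    and mat: "\<And>v. v \<in> {A x, B y} \<Longrightarrow> is_matrix K N L (secret_mat \<sigma> v)"
      "\<And>v. v \<in> {A x, B y} \<Longrightarrow> is_matrix K N (noise_len \<sigma>) (noise_mat \<sigma> v)"
    and dec: "shannon_cond_entropy \<sigma> secret (signal_pair \<sigma> x y) = 0"
    and t: "t \<in> vectors K L"
  shows "\<exists>a\<in>vectors K N. \<exists>b\<in>vectors K N. \<forall>\<omega>\<in>outcomes \<sigma>.
    dot K L t (secret \<omega>) = dot K N a (signal_value \<sigma> (A x) \<omega>) \<oplus>\<^bsub>K\<^esub> dot K N b (signal_value \<sigma> (B y) \<omega>)"
proof -
  interpret field K by fact
  have cr: "cring (base_field \<sigma>)" using is_cring by (simp add: K_def)
  note mat' = mat[unfolded K_def L_def N_def]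
  let ?r = "\<lambda>i \<omega>. if i < N then signal_value \<sigma> (A x) \<omega> i else signal_value \<sigma> (B y) \<omega> (i - N)"
  let ?e = "\<lambda>\<omega>. dot K L t (secret \<omega>)"
  have "\<exists>c\<in>{..<N+N} \<rightarrow>\<^sub>E carrier K. \<forall>\<omega>\<in>outcomes \<sigma>. ?e \<omega> = (\<Oplus>\<^bsub>K\<^esub>i\<in>{..<N+N}. c i \<otimes>\<^bsub>K\<^esub> ?r i \<omega>)"
  proof (rule functional_in_span[where comb="outcome_comb \<sigma>"])
    show "outcome_comb \<sigma> \<omega> c \<omega>' \<in> outcomes \<sigma>"
      if "\<omega> \<in> outcomes \<sigma>" "c \<in> carrier K" "\<omega>' \<in> outcomes \<sigma>" for \<omega> c \<omega>'
      using outcome_comb_closed[OF cr] that by (simp add: K_def)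
    show "linear_functional K (outcomes \<sigma>) (outcome_comb \<sigma>) (?r i)" if "i < N + N" for i
      using linear_functional_signal[OF cr _ mat'(1,2), of i "A x"]
        linear_functional_signal[OF cr _ mat'(1,2), of "i - N" "B y"] that
      by (cases "i < N") (simp_all add: K_def N_def)
    show "linear_functional K (outcomes \<sigma>) (outcome_comb \<sigma>) ?e"
      using linear_functional_secret[OF cr] t by (simp add: K_def L_def)
    show "?e \<omega> = \<zero>\<^bsub>K\<^esub>" if \<omega>: "\<omega> \<in> outcomes \<sigma>" and 0: "\<And>i. i < N + N \<Longrightarrow> ?r i \<omega> = \<zero>\<^bsub>K\<^esub>" for \<omega>
    proof -
      have "signal_value \<sigma> v \<omega> = signal_value \<sigma> v (zero_outcome \<sigma>)" if v: "v \<in> {A x, B y}" for v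
      proof (rule vectors_eqI)
        show "signal_value \<sigma> v \<omega> \<in> vectors K N"
          "signal_value \<sigma> v (zero_outcome \<sigma>) \<in> vectors K N"
          using signal_value_closed[OF cr mat'[OF v]] \<omega> zero_outcome_closed[OF cr]
          by (simp_all add: K_def N_def)
        fix i assume i: "i < N"
        have "signal_value \<sigma> v \<omega> i = \<zero>\<^bsub>K\<^esub>"
          using 0[of i] 0[of "i + N"] i v by auto
        moreover have "signal_value \<sigma> v (zero_outcome \<sigma>) i = \<zero>\<^bsub>K\<^esub>"
          using signal_zero_outcome[OF cr _ mat'[OF v]] i by (simp add: K_def N_def)
        ultimately show "signal_value \<sigma> v \<omega> i = signal_value \<sigma> v (zero_outcome \<sigma>) i" by simp
      qed
      then have "signal_pair \<sigma> x y \<omega> = signal_pair \<sigma> x y (zero_outcome \<sigma>)"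
        by (simp add: signal_pair_def)
      then have "secret \<omega> = secret (zero_outcome \<sigma>)"
        using dec \<omega> zero_outcome_closed[OF cr]
          decodable_iff[OF assms(4,5)[unfolded K_def], of "signal_pair \<sigma> x y"] by blast
      then have "secret \<omega> i = \<zero>\<^bsub>K\<^esub>" if "i < L" for i
        using that by (simp add: secret_def zero_outcome_def K_def L_def)
      then show ?thesis
        using vectors_memD[OF t] by (intro dot_zero_right)
    qed
  qed
  then obtain c where c: "c \<in> {..<N+N} \<rightarrow>\<^sub>E carrier K"
    and c_eq: "\<And>\<omega>. \<omega> \<in> outcomes \<sigma> \<Longrightarrow> ?e \<omega> = dot K (N + N) c (\<lambda>i. ?r i \<omega>)"
    unfolding dot_def by blast
  \<comment> \<open>The first \<open>N\<close> coefficients belong to \<open>A x\<close>, the last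
    \<open>N\<close> to \<open>B y\<close>. Restriction makes both halves members of
    \<open>vectors K N\<close>.\<close>
  define a where "a = (\<lambda>i\<in>{..<N}. c i)"
  define b where "b = (\<lambda>i\<in>{..<N}. c (N + i))"
  have cc: "c i \<in> carrier K" if "i < N + N" for i
    using c that by auto
  have ab: "a \<in> vectors K N" "b \<in> vectors K N"
    using cc by (auto simp: a_def b_def vectors_def)
  have "?e \<omega> = dot K N a (signal_value \<sigma> (A x) \<omega>) \<oplus>\<^bsub>K\<^esub> dot K N b (signal_value \<sigma> (B y) \<omega>)"
    if \<omega>: "\<omega> \<in> outcomes \<sigma>" for \<omega>
  proof -
    have s: "signal_value \<sigma> v \<omega> i \<in> carrier K" if "v \<in> {A x, B y}" "i < N" for v i
      using vectors_memD[OF signal_value_closed[OF cr mat'[OF that(1)] \<omega>]] that(2)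
      by (simp add: K_def N_def)
    have "dot K (N + N) c (\<lambda>i. ?r i \<omega>) =
        dot K N c (signal_value \<sigma> (A x) \<omega>) \<oplus>\<^bsub>K\<^esub> dot K N (\<lambda>i. c (N + i)) (signal_value \<sigma> (B y) \<omega>)"
      using cc s by (intro dot_append) auto
    also have "dot K N c (signal_value \<sigma> (A x) \<omega>) = dot K N a (signal_value \<sigma> (A x) \<omega>)"
      unfolding dot_def a_def using cc s by (intro finsum_cong') auto
    also have "dot K N (\<lambda>i. c (N + i)) (signal_value \<sigma> (B y) \<omega>) = dot K N b (signal_value \<sigma> (B y) \<omega>)"
      unfolding dot_def b_def using cc s by (intro finsum_cong') auto
    finally show ?thesis using c_eq[OF \<omega>] by simp
  qed
  with ab show ?thesis by blast
qed

subsection \<open>The upper bound\<close>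

text \<open>By security some outcome with secret zero has the same view as \<open>\<omega>\<close>,
  and \<open>g\<close> depends on the view only.\<close>

lemma secure_determined:
  fixes \<sigma> :: linear_scheme
  assumes "field (base_field \<sigma>)" "finite (carrier (base_field \<sigma>))"
    and "shannon_cond_entropy \<sigma> secret (signal_pair \<sigma> x y) = shannon_entropy \<sigma> secret"
    and "\<And>\<omega> \<omega>'. signal_value \<sigma> (A x) \<omega> = signal_value \<sigma> (A x) \<omega>' \<Longrightarrow>
      signal_value \<sigma> (B y) \<omega> = signal_value \<sigma> (B y) \<omega>' \<Longrightarrow> g \<omega> = g \<omega>'"
    and "\<And>\<omega>. \<omega> \<in> outcomes \<sigma> \<Longrightarrow> secret \<omega> = secret (zero_outcome \<sigma>) \<Longrightarrow> g \<omega> = z"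
    and "\<omega> \<in> outcomes \<sigma>"
  shows "g \<omega> = z"
proof -
  interpret field "base_field \<sigma>" by fact
  obtain \<omega>' where "\<omega>' \<in> outcomes \<sigma>" "secret \<omega>' = secret (zero_outcome \<sigma>)"
    "signal_pair \<sigma> x y \<omega>' = signal_pair \<sigma> x y \<omega>"
    using secureD[OF assms(1-3) zero_outcome_closed[OF is_cring] assms(6)] by blast
  then show ?thesis
    using assms(4)[of \<omega>' \<omega>] assms(5)[of \<omega>'] by (simp add: signal_pair_def)
qed

lemma (in abelian_group) add_zero_trans:
  assumes "a \<in> carrier G" "b \<in> carrier G" "c \<in> carrier G" "a \<oplus> b = \<zero>" "b \<oplus> c = \<zero>"
  shows "a = c"
  using assms by (metis a_comm minus_equality)

text \<open>
  Here \<open>p\<^sub>k\<close> and \<open>q\<^sub>k\<close> stand for the contributions of the signals \<open>A\<close> and \<open>B\<close> on the \<open>k\<close>-th edge of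
  the path, and \<open>Z\<close> for the outcomes with secret zero.
\<close>

lemma (in abelian_group) path_collapse:
  fixes p1 q1 p2 q2 p3 q3 p4 q4 p5 q5 :: "'c \<Rightarrow> 'a"
  assumes sub: "Z \<subseteq> \<Omega>"
    and cl: "\<And>\<omega>. \<omega> \<in> \<Omega> \<Longrightarrow> p1 \<omega> \<in> carrier G \<and> q1 \<omega> \<in> carrier G \<and> p2 \<omega> \<in> carrier G \<and> q2 \<omega> \<in> carrier G \<and>
      p3 \<omega> \<in> carrier G \<and> q3 \<omega> \<in> carrier G \<and> p4 \<omega> \<in> carrier G \<and> q4 \<omega> \<in> carrier G \<and>
      p5 \<omega> \<in> carrier G \<and> q5 \<omega> \<in> carrier G"
    and edge: "\<And>\<omega>. \<omega> \<in> Z \<Longrightarrow> p1 \<omega> \<oplus> q1 \<omega> = \<zero> \<and> p2 \<omega> \<oplus> q2 \<omega> = \<zero> \<and> p3 \<omega> \<oplus> q3 \<omega> = \<zero> \<and>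
      p4 \<omega> \<oplus> q4 \<omega> = \<zero> \<and> p5 \<omega> \<oplus> q5 \<omega> = \<zero>"
    and vertex: "\<And>\<omega>. \<omega> \<in> \<Omega> \<Longrightarrow> q1 \<omega> \<oplus> q2 \<omega> = \<zero> \<and> p2 \<omega> \<oplus> p3 \<omega> = \<zero> \<and> q3 \<omega> \<oplus> q4 \<omega> = \<zero> \<and>
      p4 \<omega> \<oplus> p5 \<omega> = \<zero>"
    and p1q3: "(\<And>\<omega>. \<omega> \<in> Z \<Longrightarrow> p1 \<omega> \<oplus> q3 \<omega> = \<zero>) \<Longrightarrow> (\<And>\<omega>. \<omega> \<in> \<Omega> \<Longrightarrow> p1 \<omega> \<oplus> q3 \<omega> = \<zero>)"
    and p1q5: "(\<And>\<omega>. \<omega> \<in> Z \<Longrightarrow> p1 \<omega> \<oplus> q5 \<omega> = \<zero>) \<Longrightarrow> (\<And>\<omega>. \<omega> \<in> \<Omega> \<Longrightarrow> p1 \<omega> \<oplus> q5 \<omega> = \<zero>)"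
    and p3q5: "(\<And>\<omega>. \<omega> \<in> Z \<Longrightarrow> p3 \<omega> \<oplus> q5 \<omega> = \<zero>) \<Longrightarrow> (\<And>\<omega>. \<omega> \<in> \<Omega> \<Longrightarrow> p3 \<omega> \<oplus> q5 \<omega> = \<zero>)"
    and q1: "(\<And>\<omega>. \<omega> \<in> Z \<Longrightarrow> q1 \<omega> = \<zero>) \<Longrightarrow> (\<And>\<omega>. \<omega> \<in> \<Omega> \<Longrightarrow> q1 \<omega> = \<zero>)"
    and p4: "(\<And>\<omega>. \<omega> \<in> Z \<Longrightarrow> p4 \<omega> = \<zero>) \<Longrightarrow> (\<And>\<omega>. \<omega> \<in> \<Omega> \<Longrightarrow> p4 \<omega> = \<zero>)"
    and middle: "(\<And>\<omega>. \<omega> \<in> \<Omega> \<Longrightarrow> p3 \<omega> \<oplus> q3 \<omega> = \<zero>) \<Longrightarrow> (\<And>\<omega>. \<omega> \<in> \<Omega> \<Longrightarrow> p3 \<omega> = \<zero> \<and> q3 \<omega> = \<zero>)"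
    and \<omega>: "\<omega> \<in> \<Omega>"
  shows "p1 \<omega> \<oplus> q1 \<omega> = \<zero> \<and> p2 \<omega> \<oplus> q2 \<omega> = \<zero> \<and> p3 \<omega> \<oplus> q3 \<omega> = \<zero> \<and>
      p4 \<omega> \<oplus> q4 \<omega> = \<zero> \<and> p5 \<omega> \<oplus> q5 \<omega> = \<zero>"
proof -
  have zero_right: "b = \<zero>" if "a \<oplus> b = \<zero>" "a = \<zero>" "b \<in> carrier G" for a b
    using that by simp
  have zero_left: "a = \<zero>" if "a \<oplus> b = \<zero>" "b = \<zero>" "a \<in> carrier G" for a b
    using that by simp
  \<comment> \<open>Using edge and vertex relations alternately cancels the terms in between,
    walking along the path from \<open>p1\<close> to \<open>p5\<close>.\<close>
  have onZ: "p1 \<omega> = q2 \<omega> \<and> q2 \<omega> = p3 \<omega> \<and> p3 \<omega> = q4 \<omega> \<and> q4 \<omega> = p5 \<omega>" if "\<omega> \<in> Z" for \<omega>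
  proof -
    have w: "\<omega> \<in> \<Omega>" using sub that by blast
    note c = cl[OF w] and e = edge[OF that] and v = vertex[OF w]
    have "p1 \<omega> = q2 \<omega>" by (rule add_zero_trans[of _ "q1 \<omega>"]) (use c e v in auto)
    moreover have "q2 \<omega> = p3 \<omega>" by (rule add_zero_trans[of _ "p2 \<omega>"]) (use c e v in \<open>auto simp: a_comm\<close>)
    moreover have "p3 \<omega> = q4 \<omega>" by (rule add_zero_trans[of _ "q3 \<omega>"]) (use c e v in auto)
    moreover have "q4 \<omega> = p5 \<omega>" by (rule add_zero_trans[of _ "p4 \<omega>"]) (use c e v in \<open>auto simp: a_comm\<close>)
    ultimately show ?thesis by simp
  qed
  \<comment> \<open>On \<open>Z\<close> the terms \<open>p1\<close>, \<open>p3\<close> and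
    \<open>p5\<close> agree, so each of the next three sums is there the sum on a single edge of the
    path and hence zero. The security hypotheses extend this from \<open>Z\<close> to
    \<open>\<Omega>\<close>.\<close>
  have 13: "p1 \<omega> \<oplus> q3 \<omega> = \<zero>" if "\<omega> \<in> \<Omega>" for \<omega>
    using p1q3[OF _ that] onZ edge by simp
  have 15: "p1 \<omega> \<oplus> q5 \<omega> = \<zero>" if "\<omega> \<in> \<Omega>" for \<omega>
    using p1q5[OF _ that] onZ edge by simp
  have 35: "p3 \<omega> \<oplus> q5 \<omega> = \<zero>" if "\<omega> \<in> \<Omega>" for \<omega>
    using p3q5[OF _ that] onZ edge by simp
  \<comment> \<open>Both \<open>p1\<close> and \<open>p3\<close> are the negative of
    \<open>q5\<close>, so \<open>p3\<close> may replace \<open>p1\<close> in fact \<open>13\<close>.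
    This gives the relation of the middle edge on all of \<open>\<Omega>\<close>.\<close>
  have "p3 \<omega> \<oplus> q3 \<omega> = \<zero>" if w: "\<omega> \<in> \<Omega>" for \<omega>
  proof -
    have "p3 \<omega> = p1 \<omega>"
      by (rule add_zero_trans[of _ "q5 \<omega>"]) (use cl[OF w] 35[OF w] 15[OF w] in \<open>auto simp: a_comm\<close>)
    then show ?thesis using 13[OF w] by simp
  qed
  then have mid: "p3 \<omega> = \<zero>" "q3 \<omega> = \<zero>" if "\<omega> \<in> \<Omega>" for \<omega>
    using middle that by blast+
  have z: "p2 \<omega> = \<zero>" "q4 \<omega> = \<zero>" "p1 \<omega> = \<zero>" "q5 \<omega> = \<zero>" if w: "\<omega> \<in> \<Omega>" for \<omega>
    using zero_left[of "p2 \<omega>" "p3 \<omega>"] zero_right[of "q3 \<omega>" "q4 \<omega>"] zero_left[of "p1 \<omega>" "q3 \<omega>"]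
      zero_right[of "p3 \<omega>" "q5 \<omega>"] mid[OF w] cl[OF w] vertex[OF w] 13[OF w] 35[OF w] by simp_all
  \<comment> \<open>For \<open>q1\<close> and \<open>p4\<close> only the edge relations are at hand,
    which hold on \<open>Z\<close>. The hypotheses of the same names carry the vanishing to
    \<open>\<Omega>\<close>, and the vertex relations then reach \<open>q2\<close> and
    \<open>p5\<close>.\<close>
  have "q1 \<omega> = \<zero>" if "\<omega> \<in> Z" for \<omega>
    using zero_right[of "p1 \<omega>" "q1 \<omega>"] z(3) edge[OF that] cl sub that by blast
  then have q1z: "q1 \<omega> = \<zero>" if "\<omega> \<in> \<Omega>" for \<omega> using q1 that by blast
  have "p4 \<omega> = \<zero>" if "\<omega> \<in> Z" for \<omega>
    using zero_left[of "p4 \<omega>" "q4 \<omega>"] z(2) edge[OF that] cl sub that by blast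
  then have p4z: "p4 \<omega> = \<zero>" if "\<omega> \<in> \<Omega>" for \<omega> using p4 that by blast
  have "q2 \<omega> = \<zero>" "p5 \<omega> = \<zero>"
    using zero_right[of "q1 \<omega>" "q2 \<omega>"] zero_right[of "p4 \<omega>" "p5 \<omega>"] q1z p4z cl vertex \<omega> by blast+
  then show ?thesis using z[OF \<omega>] mid[OF \<omega>] q1z[OF \<omega>] p4z[OF \<omega>] by simp
qed

text \<open>Every unit vector occurs as a secret, and its dot product with \<open>t\<close> reads
  off one coordinate.\<close>

lemma secret_separates:
  fixes \<sigma> :: linear_scheme
  defines "K \<equiv> base_field \<sigma>" and "L \<equiv> secret_len \<sigma>"
  assumes "field K" "t \<in> vectors K L" "t' \<in> vectors K L"
    and eq: "\<And>\<omega>. \<omega> \<in> outcomes \<sigma> \<Longrightarrow> dot K L t (secret \<omega>) = dot K L t' (secret \<omega>)"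
  shows "t = t'"
proof (rule vectors_eqI[OF assms(4,5)])
  fix j assume j: "j < L"
  interpret field K by fact
  let ?\<omega> = "(\<lambda>i\<in>{..<L}. if i = j then \<one>\<^bsub>K\<^esub> else \<zero>\<^bsub>K\<^esub>, snd (zero_outcome \<sigma>))"
  have "?\<omega> \<in> outcomes \<sigma>"
    using zero_outcome_closed[of \<sigma>] is_cring
    by (auto simp: outcomes_def vectors_def simp flip: K_def L_def)
  from eq[OF this] show "t j = t' j"
    using dot_unit[OF vectors_memD[OF assms(4)] j] dot_unit[OF vectors_memD[OF assms(5)] j]
    by (simp add: secret_def)
qed

lemma secret_len_bound:
  assumes "linear_cds_scheme example_cds \<sigma>"
  shows "5 * secret_len \<sigma> \<le> 4 * signal_len \<sigma>"
proof -
  define K L N \<Omega> where "K = base_field \<sigma>" and "L = secret_len \<sigma>" and "N = signal_len \<sigma>"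
    and "\<Omega> = outcomes \<sigma>"
  have fld: "field K" and fin: "finite (carrier K)"
    using assms by (auto simp: linear_cds_scheme_def K_def)
  interpret field K by (rule fld)
  have mat: "is_matrix K N L (secret_mat \<sigma> v)" "is_matrix K N (noise_len \<sigma>) (noise_mat \<sigma> v)"
    if "v \<in> {A 1, A 2, A 3, B 1, B 2, B 3}" for v
  proof -
    have "v \<in> signals example_cds" using that by (auto simp: signals_def example_cds_def)
    then show "is_matrix K N L (secret_mat \<sigma> v)" "is_matrix K N (noise_len \<sigma>) (noise_mat \<sigma> v)"
      using assms by (auto simp: linear_cds_scheme_def K_def L_def N_def)
  qed
  define s where "s = signal_value \<sigma>"
  have s_cl: "s v \<omega> i \<in> carrier K"
    if "v \<in> {A 1, A 2, A 3, B 1, B 2, B 3}" "\<omega> \<in> \<Omega>" "i < N" for v \<omega> i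
    using vectors_memD[OF signal_value_closed[of \<sigma> v \<omega>], of i] mat[OF that(1)] that is_cring
    by (simp add: s_def K_def L_def N_def \<Omega>_def)
  have correct: "shannon_cond_entropy \<sigma> secret (signal_pair \<sigma> x y) = 0"
    if "(x, y) \<in> {(1, 1), (2, 1), (2, 2), (3, 2), (3, 3)}" for x y
    using assms that by (auto simp: linear_cds_scheme_def example_cds_def)
  have secure: "shannon_cond_entropy \<sigma> secret (signal_pair \<sigma> x y) = shannon_entropy \<sigma> secret"
    if "(x, y) \<in> {(1, 2), (1, 3), (2, 3), (3, 1)}" for x y
    using assms that by (auto simp: linear_cds_scheme_def example_cds_def)
  define Q :: "(nat \<times> nat) set" where "Q = {(1, 1), (2, 1), (2, 2), (3, 2), (3, 3)}"
  have "\<forall>x y t. (x, y) \<in> Q \<and> t \<in> vectors K L \<longrightarrow> (\<exists>a b. a \<in> vectors K N \<and> b \<in> vectors K N \<and>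
      (\<forall>\<omega>\<in>\<Omega>. dot K L t (secret \<omega>) = dot K N a (s (A x) \<omega>) \<oplus>\<^bsub>K\<^esub> dot K N b (s (B y) \<omega>)))"
  proof (intro allI impI)
    fix x y t assume *: "(x, y) \<in> Q \<and> t \<in> vectors K L"
    have "v \<in> {A 1, A 2, A 3, B 1, B 2, B 3}" if "v \<in> {A x, B y}" for v
      using * that by (auto simp: Q_def)
    then show "\<exists>a b. a \<in> vectors K N \<and> b \<in> vectors K N \<and>
      (\<forall>\<omega>\<in>\<Omega>. dot K L t (secret \<omega>) = dot K N a (s (A x) \<omega>) \<oplus>\<^bsub>K\<^esub> dot K N b (s (B y) \<omega>))"
      using decoding_coefficients[of \<sigma> x y t] fld fin mat correct[of x y] *
      unfolding K_def L_def N_def s_def \<Omega>_def Q_def by blast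
  qed
  \<comment> \<open>The coefficient vectors come from a choice that nothing makes linear in
    \<open>t\<close>. Injectivity below therefore compares two inputs instead of computing a
    kernel.\<close>
  then obtain a b where ab: "\<And>x y t. (x, y) \<in> Q \<Longrightarrow> t \<in> vectors K L \<Longrightarrow>
      a x y t \<in> vectors K N \<and> b x y t \<in> vectors K N"
    and decode: "\<And>x y t \<omega>. (x, y) \<in> Q \<Longrightarrow> t \<in> vectors K L \<Longrightarrow> \<omega> \<in> \<Omega> \<Longrightarrow>
      dot K L t (secret \<omega>) = dot K N (a x y t) (s (A x) \<omega>) \<oplus>\<^bsub>K\<^esub> dot K N (b x y t) (s (B y) \<omega>)"
    by metis
  let ?add = "\<lambda>c d. \<lambda>i\<in>{..<N}. c i \<oplus>\<^bsub>K\<^esub> d i"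
  \<comment> \<open>The components belong to the inner vertices \<open>B 1\<close>,
    \<open>A 2\<close>, \<open>B 2\<close>, \<open>A 3\<close> in this order. The ends
    \<open>A 1\<close> and \<open>B 3\<close> lie on one edge of the path each and get no
    component.\<close>
  define \<Phi> where "\<Phi> = (\<lambda>(t1, t2, t3, t4, t5).
    (?add (b 1 1 t1) (b 2 1 t2), ?add (a 2 1 t2) (a 2 2 t3),
     ?add (b 2 2 t3) (b 3 2 t4), ?add (a 3 2 t4) (a 3 3 t5)))"
  let ?VL = "vectors K L" and ?VN = "vectors K N"
  have Q: "(1, 1) \<in> Q" "(2, 1) \<in> Q" "(2, 2) \<in> Q" "(3, 2) \<in> Q" "(3, 3) \<in> Q"
    by (auto simp: Q_def)
  have add_cl: "?add c d \<in> ?VN" if "c \<in> ?VN" "d \<in> ?VN" for c d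
    using vectors_memD[OF that(1)] vectors_memD[OF that(2)] by (auto simp: vectors_def)
  have into: "\<Phi> ` (?VL \<times> ?VL \<times> ?VL \<times> ?VL \<times> ?VL) \<subseteq> ?VN \<times> ?VN \<times> ?VN \<times> ?VN"
    using ab Q add_cl by (auto simp: \<Phi>_def)
  have inj: "inj_on \<Phi> (?VL \<times> ?VL \<times> ?VL \<times> ?VL \<times> ?VL)"
  proof (rule inj_onI)
    fix t u
    assume "t \<in> ?VL \<times> ?VL \<times> ?VL \<times> ?VL \<times> ?VL" "u \<in> ?VL \<times> ?VL \<times> ?VL \<times> ?VL \<times> ?VL"
      and \<Phi>_eq: "\<Phi> t = \<Phi> u"
    then obtain t1 t2 t3 t4 t5 u1 u2 u3 u4 u5
      where tu: "t = (t1, t2, t3, t4, t5)" "u = (u1, u2, u3, u4, u5)"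
      and t: "t1 \<in> ?VL" "t2 \<in> ?VL" "t3 \<in> ?VL" "t4 \<in> ?VL" "t5 \<in> ?VL"
      and u: "u1 \<in> ?VL" "u2 \<in> ?VL" "u3 \<in> ?VL" "u4 \<in> ?VL" "u5 \<in> ?VL"
      by auto
    note eq = \<Phi>_eq[unfolded tu]
    let ?P = "\<lambda>x y t \<omega>. dot K N (a x y t) (s (A x) \<omega>)"
    let ?Q = "\<lambda>x y t \<omega>. dot K N (b x y t) (s (B y) \<omega>)"
    \<comment> \<open>Differences of the contributions of two colliding inputs on one edge; they
      will be the \<open>p1\<close>, \<open>q1\<close>, and so on, of
      \<open>path_collapse\<close>.\<close>
    let ?p = "\<lambda>x y t u \<omega>. ?P x y t \<omega> \<ominus>\<^bsub>K\<^esub> ?P x y u \<omega>"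
    let ?q = "\<lambda>x y t u \<omega>. ?Q x y t \<omega> \<ominus>\<^bsub>K\<^esub> ?Q x y u \<omega>"
    have P_cl: "?P x y t \<omega> \<in> carrier K" and Q_cl: "?Q x y t \<omega> \<in> carrier K"
      if "(x, y) \<in> Q" "t \<in> ?VL" "\<omega> \<in> \<Omega>" for x y t \<omega>
    proof -
      have v: "A x \<in> {A 1, A 2, A 3, B 1, B 2, B 3}" "B y \<in> {A 1, A 2, A 3, B 1, B 2, B 3}"
        using that(1) by (auto simp: Q_def)
      show "?P x y t \<omega> \<in> carrier K" "?Q x y t \<omega> \<in> carrier K"
        using ab[OF that(1,2)] s_cl[OF v(1) that(3)] s_cl[OF v(2) that(3)]
        by (auto intro!: dot_closed simp: vectors_memD[where K=K])
    qed
    have D: "?p x y t u \<omega> \<oplus>\<^bsub>K\<^esub> ?q x y t u \<omega> = dot K L t (secret \<omega>) \<ominus>\<^bsub>K\<^esub> dot K L u (secret \<omega>)"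
      if "(x, y) \<in> Q" "t \<in> ?VL" "u \<in> ?VL" "\<omega> \<in> \<Omega>" for x y t u \<omega>
      unfolding decode[OF that(1,2,4)] decode[OF that(1,3,4)]
      using P_cl[OF that(1,2,4)] P_cl[OF that(1,3,4)] Q_cl[OF that(1,2,4)] Q_cl[OF that(1,3,4)]
      by algebra
    have sec_cl: "dot K L t (secret \<omega>) \<in> carrier K" if "t \<in> ?VL" "\<omega> \<in> \<Omega>" for t \<omega>
      using decode[OF Q(1) that] P_cl[OF Q(1) that] Q_cl[OF Q(1) that] by simp
    \<comment> \<open>By \<open>D\<close> the sum on an edge is the difference of the dot products
      of \<open>t\<close> and \<open>u\<close> with the secret, and these dot products determine
      \<open>t\<close> and \<open>u\<close>.\<close>
    have recover: "t = u"
      if "(x, y) \<in> Q" "t \<in> ?VL" "u \<in> ?VL" "\<And>\<omega>. \<omega> \<in> \<Omega> \<Longrightarrow> ?p x y t u \<omega> \<oplus>\<^bsub>K\<^esub> ?q x y t u \<omega> = \<zero>\<^bsub>K\<^esub>"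
      for x y t u
    proof -
      note xy = that
      have "dot K L t (secret \<omega>) = dot K L u (secret \<omega>)" if w: "\<omega> \<in> \<Omega>" for \<omega>
        using r_right_minus_eq[OF sec_cl[OF xy(2) w] sec_cl[OF xy(3) w]] D[OF xy(1-3) w] xy(4)[OF w]
        by (metis (no_types))
      then show ?thesis
        using secret_separates[of \<sigma> t u] fld that(2,3) by (simp add: K_def L_def \<Omega>_def)
    qed
    \<comment> \<open>Equal components of \<open>\<Phi>\<close> mean that the contributions of the
      two edges at an inner vertex cancel; \<open>x\<close> will be the value of the signal at that
      vertex.\<close>
    have collide: "(dot K N c1 x \<ominus>\<^bsub>K\<^esub> dot K N c2 x) \<oplus>\<^bsub>K\<^esub> (dot K N d1 x \<ominus>\<^bsub>K\<^esub> dot K N d2 x) = \<zero>\<^bsub>K\<^esub>"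
      if "?add c1 d1 = ?add c2 d2" "c1 \<in> ?VN" "c2 \<in> ?VN" "d1 \<in> ?VN" "d2 \<in> ?VN"
        "\<And>i. i < N \<Longrightarrow> x i \<in> carrier K" for c1 c2 d1 d2 x
    proof -
      note m = vectors_memD[OF that(2)] vectors_memD[OF that(3)] vectors_memD[OF that(4)]
        vectors_memD[OF that(5)]
      have "dot K N c1 x \<oplus>\<^bsub>K\<^esub> dot K N d1 x = dot K N c2 x \<oplus>\<^bsub>K\<^esub> dot K N d2 x"
        using dot_add_left[of N c1 d1 x] dot_add_left[of N c2 d2 x] m that(1,6) by simp
      moreover have cl: "dot K N c1 x \<in> carrier K" "dot K N d1 x \<in> carrier K"
        "dot K N c2 x \<in> carrier K" "dot K N d2 x \<in> carrier K"
        using m that(6) by (auto intro: dot_closed)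
      moreover have "(dot K N c1 x \<ominus>\<^bsub>K\<^esub> dot K N c2 x) \<oplus>\<^bsub>K\<^esub> (dot K N d1 x \<ominus>\<^bsub>K\<^esub> dot K N d2 x) =
          (dot K N c1 x \<oplus>\<^bsub>K\<^esub> dot K N d1 x) \<ominus>\<^bsub>K\<^esub> (dot K N c2 x \<oplus>\<^bsub>K\<^esub> dot K N d2 x)"
        using cl by algebra
      ultimately show ?thesis by simp
    qed
    define Z where "Z = {\<omega>\<in>\<Omega>. secret \<omega> = secret (zero_outcome \<sigma>)}"
    have ZD: "\<omega> \<in> \<Omega>" "dot K L t (secret \<omega>) = \<zero>\<^bsub>K\<^esub>" if "\<omega> \<in> Z" "t \<in> ?VL" for \<omega> t
    proof -
      show "\<omega> \<in> \<Omega>" using that(1) by (simp add: Z_def)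
      have "secret \<omega> = secret (zero_outcome \<sigma>)" using that(1) by (simp add: Z_def)
      then have "secret \<omega> i = \<zero>\<^bsub>K\<^esub>" if "i < L" for i
        using that by (simp add: secret_def zero_outcome_def K_def L_def)
      then show "dot K L t (secret \<omega>) = \<zero>\<^bsub>K\<^esub>"
        using vectors_memD[OF that(2)] by (intro dot_zero_right)
    qed
    have onZ: "?p x y t u \<omega> \<oplus>\<^bsub>K\<^esub> ?q x y t u \<omega> = \<zero>\<^bsub>K\<^esub>"
      if "(x, y) \<in> Q" "t \<in> ?VL" "u \<in> ?VL" "\<omega> \<in> Z" for x y t u \<omega>
      using D[OF that(1-3) ZD(1)[OF that(4,2)]] ZD(2)[OF that(4)] that(2,3) by (simp add: a_minus_def)
    \<comment> \<open>\<open>g\<close> will be one of the five expressions in the security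
      hypotheses of \<open>path_collapse\<close>, each a function of the two signals of an
      unqualified edge.\<close>
    have det: "g \<omega> = \<zero>\<^bsub>K\<^esub>"
      if xy: "(x, y) \<in> {(1, 2), (1, 3), (2, 3), (3, 1)}"
        and g: "\<And>\<omega> \<omega>'. s (A x) \<omega> = s (A x) \<omega>' \<Longrightarrow> s (B y) \<omega> = s (B y) \<omega>' \<Longrightarrow> g \<omega> = g \<omega>'"
        and g0: "\<And>\<omega>. \<omega> \<in> Z \<Longrightarrow> g \<omega> = \<zero>\<^bsub>K\<^esub>" and \<omega>: "\<omega> \<in> \<Omega>" for x y g \<omega>
      by (rule secure_determined[OF fld[unfolded K_def] fin[unfolded K_def] secure[OF xy]
            g[unfolded s_def] g0 \<omega>[unfolded \<Omega>_def]])
        (simp_all add: Z_def \<Omega>_def)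
    have v: "A 1 \<in> {A 1, A 2, A 3, B 1, B 2, B 3}" "A 2 \<in> {A 1, A 2, A 3, B 1, B 2, B 3}"
      "A 3 \<in> {A 1, A 2, A 3, B 1, B 2, B 3}" "B 1 \<in> {A 1, A 2, A 3, B 1, B 2, B 3}"
      "B 2 \<in> {A 1, A 2, A 3, B 1, B 2, B 3}" "B 3 \<in> {A 1, A 2, A 3, B 1, B 2, B 3}" by auto
    have "?p 1 1 t1 u1 \<omega> \<oplus>\<^bsub>K\<^esub> ?q 1 1 t1 u1 \<omega> = \<zero>\<^bsub>K\<^esub> \<and> ?p 2 1 t2 u2 \<omega> \<oplus>\<^bsub>K\<^esub> ?q 2 1 t2 u2 \<omega> = \<zero>\<^bsub>K\<^esub> \<and>
      ?p 2 2 t3 u3 \<omega> \<oplus>\<^bsub>K\<^esub> ?q 2 2 t3 u3 \<omega> = \<zero>\<^bsub>K\<^esub> \<and> ?p 3 2 t4 u4 \<omega> \<oplus>\<^bsub>K\<^esub> ?q 3 2 t4 u4 \<omega> = \<zero>\<^bsub>K\<^esub> \<and>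
      ?p 3 3 t5 u5 \<omega> \<oplus>\<^bsub>K\<^esub> ?q 3 3 t5 u5 \<omega> = \<zero>\<^bsub>K\<^esub>" if "\<omega> \<in> \<Omega>" for \<omega>
    proof (rule path_collapse[of Z \<Omega> "?p 1 1 t1 u1" "?q 1 1 t1 u1"
          "?p 2 1 t2 u2" "?q 2 1 t2 u2" "?p 2 2 t3 u3" "?q 2 2 t3 u3"
          "?p 3 2 t4 u4" "?q 3 2 t4 u4" "?p 3 3 t5 u5" "?q 3 3 t5 u5" \<omega>])
      show "\<omega> \<in> \<Omega>" by (rule that)
      show "Z \<subseteq> \<Omega>" by (auto simp: Z_def)
      show "?p 1 1 t1 u1 \<omega> \<in> carrier K \<and> ?q 1 1 t1 u1 \<omega> \<in> carrier K \<and>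
        ?p 2 1 t2 u2 \<omega> \<in> carrier K \<and> ?q 2 1 t2 u2 \<omega> \<in> carrier K \<and>
        ?p 2 2 t3 u3 \<omega> \<in> carrier K \<and> ?q 2 2 t3 u3 \<omega> \<in> carrier K \<and>
        ?p 3 2 t4 u4 \<omega> \<in> carrier K \<and> ?q 3 2 t4 u4 \<omega> \<in> carrier K \<and>
        ?p 3 3 t5 u5 \<omega> \<in> carrier K \<and> ?q 3 3 t5 u5 \<omega> \<in> carrier K" if "\<omega> \<in> \<Omega>" for \<omega>
        by (intro conjI minus_closed P_cl Q_cl Q t u that)
      show "?p 1 1 t1 u1 \<omega> \<oplus>\<^bsub>K\<^esub> ?q 1 1 t1 u1 \<omega> = \<zero>\<^bsub>K\<^esub> \<and> ?p 2 1 t2 u2 \<omega> \<oplus>\<^bsub>K\<^esub> ?q 2 1 t2 u2 \<omega> = \<zero>\<^bsub>K\<^esub> \<and>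
        ?p 2 2 t3 u3 \<omega> \<oplus>\<^bsub>K\<^esub> ?q 2 2 t3 u3 \<omega> = \<zero>\<^bsub>K\<^esub> \<and> ?p 3 2 t4 u4 \<omega> \<oplus>\<^bsub>K\<^esub> ?q 3 2 t4 u4 \<omega> = \<zero>\<^bsub>K\<^esub> \<and>
        ?p 3 3 t5 u5 \<omega> \<oplus>\<^bsub>K\<^esub> ?q 3 3 t5 u5 \<omega> = \<zero>\<^bsub>K\<^esub>" if "\<omega> \<in> Z" for \<omega>
        by (intro conjI onZ Q t u that)
      show "?q 1 1 t1 u1 \<omega> \<oplus>\<^bsub>K\<^esub> ?q 2 1 t2 u2 \<omega> = \<zero>\<^bsub>K\<^esub> \<and> ?p 2 1 t2 u2 \<omega> \<oplus>\<^bsub>K\<^esub> ?p 2 2 t3 u3 \<omega> = \<zero>\<^bsub>K\<^esub> \<and>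
        ?q 2 2 t3 u3 \<omega> \<oplus>\<^bsub>K\<^esub> ?q 3 2 t4 u4 \<omega> = \<zero>\<^bsub>K\<^esub> \<and> ?p 3 2 t4 u4 \<omega> \<oplus>\<^bsub>K\<^esub> ?p 3 3 t5 u5 \<omega> = \<zero>\<^bsub>K\<^esub>"
        if "\<omega> \<in> \<Omega>" for \<omega>
        using eq unfolding \<Phi>_def prod.case prod.inject
        by (intro conjI collide ab[THEN conjunct1] ab[THEN conjunct2] Q t u s_cl[OF _ that] v)
          blast+
      show "?p 1 1 t1 u1 \<omega> \<oplus>\<^bsub>K\<^esub> ?q 2 2 t3 u3 \<omega> = \<zero>\<^bsub>K\<^esub>"
        if "\<And>\<omega>. \<omega> \<in> Z \<Longrightarrow> ?p 1 1 t1 u1 \<omega> \<oplus>\<^bsub>K\<^esub> ?q 2 2 t3 u3 \<omega> = \<zero>\<^bsub>K\<^esub>" "\<omega> \<in> \<Omega>" for \<omega>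
        by (rule det[where x=1 and y=2 and g="\<lambda>\<omega>. ?p 1 1 t1 u1 \<omega> \<oplus>\<^bsub>K\<^esub> ?q 2 2 t3 u3 \<omega>", OF _ _ that]) simp_all
      show "?p 1 1 t1 u1 \<omega> \<oplus>\<^bsub>K\<^esub> ?q 3 3 t5 u5 \<omega> = \<zero>\<^bsub>K\<^esub>"
        if "\<And>\<omega>. \<omega> \<in> Z \<Longrightarrow> ?p 1 1 t1 u1 \<omega> \<oplus>\<^bsub>K\<^esub> ?q 3 3 t5 u5 \<omega> = \<zero>\<^bsub>K\<^esub>" "\<omega> \<in> \<Omega>" for \<omega>
        by (rule det[where x=1 and y=3 and g="\<lambda>\<omega>. ?p 1 1 t1 u1 \<omega> \<oplus>\<^bsub>K\<^esub> ?q 3 3 t5 u5 \<omega>", OF _ _ that]) simp_all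
      show "?p 2 2 t3 u3 \<omega> \<oplus>\<^bsub>K\<^esub> ?q 3 3 t5 u5 \<omega> = \<zero>\<^bsub>K\<^esub>"
        if "\<And>\<omega>. \<omega> \<in> Z \<Longrightarrow> ?p 2 2 t3 u3 \<omega> \<oplus>\<^bsub>K\<^esub> ?q 3 3 t5 u5 \<omega> = \<zero>\<^bsub>K\<^esub>" "\<omega> \<in> \<Omega>" for \<omega>
        by (rule det[where x=2 and y=3 and g="\<lambda>\<omega>. ?p 2 2 t3 u3 \<omega> \<oplus>\<^bsub>K\<^esub> ?q 3 3 t5 u5 \<omega>", OF _ _ that]) simp_all
      \<comment> \<open>A function of \<open>B 1\<close> alone, or below of \<open>A 3\<close>
        alone, is in particular a function of the view of the unqualified pair
        \<open>(3, 1)\<close>.\<close>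
      show "?q 1 1 t1 u1 \<omega> = \<zero>\<^bsub>K\<^esub>"
        if "\<And>\<omega>. \<omega> \<in> Z \<Longrightarrow> ?q 1 1 t1 u1 \<omega> = \<zero>\<^bsub>K\<^esub>" "\<omega> \<in> \<Omega>" for \<omega>
        by (rule det[where x=3 and y=1 and g="\<lambda>\<omega>. ?q 1 1 t1 u1 \<omega>", OF _ _ that]) simp_all
      show "?p 3 2 t4 u4 \<omega> = \<zero>\<^bsub>K\<^esub>"
        if "\<And>\<omega>. \<omega> \<in> Z \<Longrightarrow> ?p 3 2 t4 u4 \<omega> = \<zero>\<^bsub>K\<^esub>" "\<omega> \<in> \<Omega>" for \<omega>
        by (rule det[where x=3 and y=1 and g="\<lambda>\<omega>. ?p 3 2 t4 u4 \<omega>", OF _ _ that]) simp_all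
      show "?p 2 2 t3 u3 \<omega> = \<zero>\<^bsub>K\<^esub> \<and> ?q 2 2 t3 u3 \<omega> = \<zero>\<^bsub>K\<^esub>"
        if "\<And>\<omega>. \<omega> \<in> \<Omega> \<Longrightarrow> ?p 2 2 t3 u3 \<omega> \<oplus>\<^bsub>K\<^esub> ?q 2 2 t3 u3 \<omega> = \<zero>\<^bsub>K\<^esub>" "\<omega> \<in> \<Omega>" for \<omega>
      proof -
        \<comment> \<open>Once the two inputs agree on the middle edge, each of the two
          contributions is a difference of equal terms.\<close>
        have "t3 = u3" by (rule recover[OF Q(3) t(3) u(3) that(1)])
        then show ?thesis
          using P_cl[OF Q(3) u(3) that(2)] Q_cl[OF Q(3) u(3) that(2)] by (simp add: a_minus_def r_neg)
      qed
    qed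
    then have "t1 = u1 \<and> t2 = u2 \<and> t3 = u3 \<and> t4 = u4 \<and> t5 = u5"
      using recover[OF Q(1) t(1) u(1)] recover[OF Q(2) t(2) u(2)] recover[OF Q(3) t(3) u(3)]
        recover[OF Q(4) t(4) u(4)] recover[OF Q(5) t(5) u(5)] by blast
    then show "t = u" by (simp add: tu)
  qed
  have "card (?VL \<times> ?VL \<times> ?VL \<times> ?VL \<times> ?VL) \<le> card (?VN \<times> ?VN \<times> ?VN \<times> ?VN)"
    using inj into finite_vectors[OF fin] by (intro card_inj_on_le) auto
  \<comment> \<open>The exponents keep the nesting of the products, so \<open>power_add\<close>
    suffices. The base exceeds 1, hence the exponents can be compared.\<close>
  then have "card (carrier K) ^ (L + (L + (L + (L + L)))) \<le> card (carrier K) ^ (N + (N + (N + N)))"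
    by (simp only: card_cartesian_product card_vectors power_add)
  then have "L + (L + (L + (L + L))) \<le> N + (N + (N + N))"
    using card_carrier_gt_1[OF fin] by (simp only: power_increasing_iff)
  then show ?thesis
    by (simp add: L_def N_def)
qed

subsection \<open>A scheme of rate 2/5\<close>

definition F2 :: "nat ring" where
  "F2 = \<lparr>carrier = {0, 1}, mult = (*), one = 1, zero = 0, add = (\<lambda>x y. (x + y) mod 2)\<rparr>"

lemma F2_simps [simp]:
  "carrier F2 = {0, 1}" "x \<otimes>\<^bsub>F2\<^esub> y = x * y" "\<one>\<^bsub>F2\<^esub> = 1" "\<zero>\<^bsub>F2\<^esub> = 0" "x \<oplus>\<^bsub>F2\<^esub> y = (x + y) mod 2"
  by (simp_all add: F2_def)

lemma field_F2: "field F2"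
proof -
  have "cring F2"
    by (rule cringI; (rule abelian_groupI | rule comm_monoidI)?) (auto simp: mod_simps)
  then show ?thesis
    by (rule cring.cring_fieldI2) auto
qed

text \<open>Moves sums in the field to the natural numbers, where parity reasoning is
  available.\<close>

lemma finsum_F2:
  assumes "finite I" "\<And>i. i \<in> I \<Longrightarrow> f i \<in> {0, 1}"
  shows "(\<Oplus>\<^bsub>F2\<^esub>i\<in>I. f i) = (\<Sum>i\<in>I. f i) mod 2"
proof -
  interpret field F2 by (rule field_F2)
  show ?thesis
    using assms
  proof (induction I)
    case empty
    then show ?case by simp
  next
    case (insert i I)
    then show ?case by (subst finsum_insert) (auto simp: mod_simps)
  qed
qed

text \<open>
  Along the path, the signals are masked by sliding windows of the noise, consecutive windows sharing
  four symbols. The secret symbols are added such that the terms on the shared noise symbols differ by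
  a basis of \<open>K\<^sup>4\<close> on qualified edges and coincide on unqualified ones. Entry \<open>i\<close> of the lists below is
  the set of column indices of the nonzero entries in row \<open>i\<close>.
\<close>

definition secret_support :: "signal \<Rightarrow> nat set list" where
  "secret_support v =
    (if v = A 1 then [{3}, {1}, {0}, {1}, {}]
     else if v = B 1 then [{}, {}, {0, 2}, {0, 1}, {3}]
     else if v = A 2 then [{0}, {}, {}, {}, {}]
     else if v = B 2 then [{0}, {1}, {2}, {3}, {2}]
     else if v = A 3 then [{0, 1}, {3}, {1, 3}, {}, {}]
     else [{}, {}, {0}, {2}, {}])"

definition noise_support :: "signal \<Rightarrow> nat set list" where
  "noise_support v =
    (if v = A 1 then [{0}, {1}, {2}, {3}, {}]
     else if v = B 1 then [{0}, {1}, {2}, {3}, {4}]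
     else if v = A 2 then [{1}, {2}, {3}, {4}, {5}]
     else if v = B 2 then [{2}, {3}, {4}, {5}, {6}]
     else if v = A 3 then [{3}, {4}, {5}, {6}, {7}]
     else [{4}, {5}, {6}, {7}, {}])"

definition window_scheme :: linear_scheme where
  "window_scheme = \<lparr>base_field = F2, secret_len = 4, noise_len = 8, signal_len = 5,
     secret_mat = (\<lambda>v i j. of_bool (j \<in> secret_support v ! i)),
     noise_mat = (\<lambda>v i j. of_bool (j \<in> noise_support v ! i))\<rparr>"

lemma window_scheme_simps [simp]:
  "base_field window_scheme = F2" "secret_len window_scheme = 4" "noise_len window_scheme = 8"
  "signal_len window_scheme = 5"
  "secret_mat window_scheme v i j = of_bool (j \<in> secret_support v ! i)"
  "noise_mat window_scheme v i j = of_bool (j \<in> noise_support v ! i)"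
  by (simp_all add: window_scheme_def)

section \<open>Signals of the scheme as parities\<close>

lemma outcomes_window:
  "outcomes window_scheme = ({..<4} \<rightarrow>\<^sub>E {0, 1}) \<times> ({..<8} \<rightarrow>\<^sub>E {0, 1})"
  by (simp add: outcomes_def vectors_def)

lemma outcomes_windowD:
  assumes "\<omega> \<in> outcomes window_scheme"
  shows "secret \<omega> \<in> {..<4} \<rightarrow>\<^sub>E {0, 1}" "noise \<omega> \<in> {..<8} \<rightarrow>\<^sub>E {0, 1}"
  using assms by (simp_all add: outcomes_window mem_Times_iff secret_def noise_def)

lemma signal_window:
  assumes "\<omega> \<in> outcomes window_scheme" "i < 5"
  shows "signal_value window_scheme v \<omega> i =
    ((\<Sum>j<4. of_bool (j \<in> secret_support v ! i) * secret \<omega> j) +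
     (\<Sum>j<8. of_bool (j \<in> noise_support v ! i) * noise \<omega> j)) mod 2"
proof -
  have s: "secret \<omega> j \<in> {0, 1}" if "j < 4" for j
    using PiE_mem[OF outcomes_windowD(1)[OF assms(1)]] that by blast
  have z: "noise \<omega> j \<in> {0, 1}" if "j < 8" for j
    using PiE_mem[OF outcomes_windowD(2)[OF assms(1)]] that by blast
  have "(\<Oplus>\<^bsub>F2\<^esub>j\<in>{..<4}. of_bool (j \<in> secret_support v ! i) * secret \<omega> j) =
      (\<Sum>j<4. of_bool (j \<in> secret_support v ! i) * secret \<omega> j) mod 2"
    by (rule finsum_F2) (use s in \<open>auto simp: of_bool_def\<close>)
  moreover have "(\<Oplus>\<^bsub>F2\<^esub>j\<in>{..<8}. of_bool (j \<in> noise_support v ! i) * noise \<omega> j) =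
      (\<Sum>j<8. of_bool (j \<in> noise_support v ! i) * noise \<omega> j) mod 2"
    by (rule finsum_F2) (use z in \<open>auto simp: of_bool_def\<close>)
  ultimately show ?thesis
    using assms(2) by (simp add: signal_value_def Let_def mod_simps)
qed

text \<open>Under \<open>odd\<close>, addition in \<open>F2\<close> becomes exclusive or, written
  \<open>\<noteq>\<close> on truth values, so correctness and security turn into propositional
  checks. The entries \<open>False\<close> are the zero rows that pad \<open>A 1\<close> and
  \<open>B 3\<close> to length 5.\<close>

lemma signal_window_parity:
  assumes "\<omega> \<in> outcomes window_scheme"
  defines "s \<equiv> \<lambda>j. odd (secret \<omega> j)" and "z \<equiv> \<lambda>j. odd (noise \<omega> j)"
  shows
    "map (\<lambda>i. odd (signal_value window_scheme (A 1) \<omega> i)) [0, 1, 2, 3, 4] =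
       [z 0 \<noteq> s 3, z 1 \<noteq> s 1, z 2 \<noteq> s 0, z 3 \<noteq> s 1, False]" (is ?A1)
    "map (\<lambda>i. odd (signal_value window_scheme (B 1) \<omega> i)) [0, 1, 2, 3, 4] =
       [z 0, z 1, z 2 \<noteq> (s 0 \<noteq> s 2), z 3 \<noteq> (s 0 \<noteq> s 1), z 4 \<noteq> s 3]" (is ?B1)
    "map (\<lambda>i. odd (signal_value window_scheme (A 2) \<omega> i)) [0, 1, 2, 3, 4] =
       [z 1 \<noteq> s 0, z 2, z 3, z 4, z 5]" (is ?A2)
    "map (\<lambda>i. odd (signal_value window_scheme (B 2) \<omega> i)) [0, 1, 2, 3, 4] =
       [z 2 \<noteq> s 0, z 3 \<noteq> s 1, z 4 \<noteq> s 2, z 5 \<noteq> s 3, z 6 \<noteq> s 2]" (is ?B2)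
    "map (\<lambda>i. odd (signal_value window_scheme (A 3) \<omega> i)) [0, 1, 2, 3, 4] =
       [z 3 \<noteq> (s 0 \<noteq> s 1), z 4 \<noteq> s 3, z 5 \<noteq> (s 1 \<noteq> s 3), z 6, z 7]" (is ?A3)
    "map (\<lambda>i. odd (signal_value window_scheme (B 3) \<omega> i)) [0, 1, 2, 3, 4] =
       [z 4, z 5, z 6 \<noteq> s 0, z 7 \<noteq> s 2, False]" (is ?B3)
proof -
  have l: "{..<4::nat} = {0, 1, 2, 3}" "{..<8::nat} = {0, 1, 2, 3, 4, 5, 6, 7}" by auto
  show ?A1 ?B1 ?A2 ?B2 ?A3 ?B3
    unfolding s_def z_def
    by (simp_all add: secret_support_def noise_support_def signal_window[OF assms(1)] l) blast+
qed

text \<open>The coordinates are residues modulo 2 and hence determined by their parities.\<close>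

lemma signal_window_eq_iff:
  assumes "\<omega> \<in> outcomes window_scheme" "\<omega>' \<in> outcomes window_scheme"
  shows "signal_value window_scheme v \<omega> = signal_value window_scheme v \<omega>' \<longleftrightarrow>
    map (\<lambda>i. odd (signal_value window_scheme v \<omega> i)) [0, 1, 2, 3, 4] =
    map (\<lambda>i. odd (signal_value window_scheme v \<omega>' i)) [0, 1, 2, 3, 4]" (is "?l \<longleftrightarrow> ?r")
proof
  assume ?r
  show ?l
  proof
    fix i
    show "signal_value window_scheme v \<omega> i = signal_value window_scheme v \<omega>' i"
    proof (cases "i < 5")
      case True
      then have "i \<in> {0, 1, 2, 3, 4}" by auto
      then have "odd (signal_value window_scheme v \<omega> i) = odd (signal_value window_scheme v \<omega>' i)"
        using \<open>?r\<close> by auto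
      then show ?thesis
        unfolding signal_window[OF assms(1) True] signal_window[OF assms(2) True] even_mod_2_iff
        unfolding mod2_eq_if by presburger
    next
      \<comment> \<open>Beyond the signal length both restricted functions take the value
        \<open>undefined\<close>.\<close>
      case False
      then show ?thesis by (simp add: signal_value_def Let_def)
    qed
  qed
qed simp

text \<open>
  Over the two-element field subtraction is addition, so changing the secret from \<open>s\<close> to \<open>u\<close>
  is compensated by adding to the noise the shift that belongs to \<open>s + u\<close>.
\<close>

definition shift_noise ::
  "((nat \<Rightarrow> nat) \<Rightarrow> nat \<Rightarrow> nat) \<Rightarrow> (nat \<Rightarrow> nat) \<Rightarrow> (nat \<Rightarrow> nat) \<times> (nat \<Rightarrow> nat) \<Rightarrow>
    (nat \<Rightarrow> nat) \<times> (nat \<Rightarrow> nat)" where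
  "shift_noise h u \<omega> = (u, \<lambda>j\<in>{..<8}. (noise \<omega> j + h (\<lambda>k. secret \<omega> k + u k) j) mod 2)"

lemma shift_noise_closed:
  "u \<in> {..<4} \<rightarrow>\<^sub>E {0, 1} \<Longrightarrow> shift_noise h u \<omega> \<in> outcomes window_scheme"
  unfolding outcomes_window shift_noise_def
  by (intro SigmaI restrict_PiE_iff[THEN iffD2] ballI) (simp_all add: mod2_eq_if)

text \<open>For a fixed secret the shift adds the same vector modulo 2 to every noise vector, and a
  translation is injective.\<close>

lemma inj_shift_noise: "inj_on (shift_noise h u) {\<omega>\<in>outcomes window_scheme. secret \<omega> = s}"
proof (rule inj_onI)
  fix \<omega> \<omega>' assume *: "\<omega> \<in> {\<omega>\<in>outcomes window_scheme. secret \<omega> = s}"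
    "\<omega>' \<in> {\<omega>\<in>outcomes window_scheme. secret \<omega> = s}"
    and eq: "shift_noise h u \<omega> = shift_noise h u \<omega>'"
  have "noise \<omega> = noise \<omega>'"
  proof (rule PiE_ext)
    show "noise \<omega> \<in> {..<8} \<rightarrow>\<^sub>E {0, 1}" "noise \<omega>' \<in> {..<8} \<rightarrow>\<^sub>E {0, 1}"
      using * outcomes_windowD(2) by blast+
    fix j :: nat assume j: "j \<in> {..<8}"
    then have "(noise \<omega> j + h (\<lambda>k. s k + u k) j) mod 2 = (noise \<omega>' j + h (\<lambda>k. s k + u k) j) mod 2"
    proof -
      have "snd (shift_noise h u \<omega>) j = snd (shift_noise h u \<omega>') j" using eq by simp
      then show ?thesis using * j by (simp add: shift_noise_def)
    qed
    moreover have "noise \<omega> j < 2" "noise \<omega>' j < 2"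
      using * j PiE_mem[OF outcomes_windowD(2)] by fastforce+
    ultimately show "noise \<omega> j = noise \<omega>' j" by presburger
  qed
  then show "\<omega> = \<omega>'" using * by (simp add: secret_def noise_def prod_eq_iff)
qed

text \<open>Shifts that leave the view unchanged inject the outcomes with one secret into those with
  any other secret, which is what \<open>uniform_cond_entropy_eq_entropy_transferI\<close> asks for.
  A single rule \<open>h\<close> serves all pairs of secrets.\<close>

lemma window_secureI:
  assumes h: "\<And>\<omega> u. \<omega> \<in> outcomes window_scheme \<Longrightarrow> u \<in> {..<4} \<rightarrow>\<^sub>E {0, 1} \<Longrightarrow>
    signal_pair window_scheme x y (shift_noise h u \<omega>) = signal_pair window_scheme x y \<omega>"
  shows "shannon_cond_entropy window_scheme secret (signal_pair window_scheme x y) =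
    shannon_entropy window_scheme secret"
  unfolding shannon_cond_entropy_def shannon_entropy_def scheme_space_outcomes space_uniform_count_measure
proof (rule uniform_cond_entropy_eq_entropy_transferI)
  show "finite (outcomes window_scheme)" "outcomes window_scheme \<noteq> {}"
    by (simp_all add: finite_outcomes outcomes_nonempty field_F2)
  show "1 < real (card (carrier (base_field window_scheme)))" by simp
  fix s u assume "u \<in> secret ` outcomes window_scheme"
  then have "u \<in> {..<4} \<rightarrow>\<^sub>E {0, 1}" by (rule imageE) (simp only: outcomes_windowD(1))
  then show "\<exists>T. inj_on T {\<omega>\<in>outcomes window_scheme. secret \<omega> = s} \<and>
      (\<forall>\<omega>\<in>outcomes window_scheme. secret \<omega> = s \<longrightarrow> T \<omega> \<in> outcomes window_scheme \<and>
         secret (T \<omega>) = u \<and> signal_pair window_scheme x y (T \<omega>) = signal_pair window_scheme x y \<omega>)"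
  proof (intro exI[of _ "shift_noise h u"] conjI ballI impI)
    show "inj_on (shift_noise h u) {\<omega>\<in>outcomes window_scheme. secret \<omega> = s}"
      by (rule inj_shift_noise)
    fix \<omega> assume "\<omega> \<in> outcomes window_scheme"
    then show "signal_pair window_scheme x y (shift_noise h u \<omega>) = signal_pair window_scheme x y \<omega>"
      using \<open>u \<in> {..<4} \<rightarrow>\<^sub>E {0, 1}\<close> by (rule h)
    show "shift_noise h u \<omega> \<in> outcomes window_scheme"
      using \<open>u \<in> {..<4} \<rightarrow>\<^sub>E {0, 1}\<close> by (rule shift_noise_closed)
    show "secret (shift_noise h u \<omega>) = u"
      by (simp add: secret_def shift_noise_def)
  qed
qed

lemma window_secure:
  assumes "(x, y) \<in> {(1, 2), (1, 3), (2, 3), (3, 1)}"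
  shows "shannon_cond_entropy window_scheme secret (signal_pair window_scheme x y) =
    shannon_entropy window_scheme secret"
proof -
  have pair: "signal_pair window_scheme x y (shift_noise h u \<omega>) = signal_pair window_scheme x y \<omega>"
    if "\<omega> \<in> outcomes window_scheme" "u \<in> {..<4} \<rightarrow>\<^sub>E {0, 1}"
      "map (\<lambda>i. odd (signal_value window_scheme (A x) (shift_noise h u \<omega>) i)) [0, 1, 2, 3, 4] =
       map (\<lambda>i. odd (signal_value window_scheme (A x) \<omega> i)) [0, 1, 2, 3, 4]"
      "map (\<lambda>i. odd (signal_value window_scheme (B y) (shift_noise h u \<omega>) i)) [0, 1, 2, 3, 4] =
       map (\<lambda>i. odd (signal_value window_scheme (B y) \<omega> i)) [0, 1, 2, 3, 4]" for x y h u \<omega>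
    using that signal_window_eq_iff[OF shift_noise_closed[OF that(2)] that(1)]
    by (simp add: signal_pair_def)
  \<comment> \<open>The natural number sum of the two secrets stands for their sum in
    \<open>F2\<close>, since only parities matter.\<close>
  have parity: "odd (secret (shift_noise h u \<omega>) j) = odd (u j)"
    "j < 8 \<Longrightarrow> odd (noise (shift_noise h u \<omega>) j) =
      (odd (noise \<omega> j) \<noteq> odd (h (\<lambda>k. secret \<omega> k + u k) j))" for h u \<omega> j
    by (simp_all add: shift_noise_def secret_def noise_def)
  note rows = signal_window_parity[OF shift_noise_closed] signal_window_parity
  from assms consider "x = 1 \<and> y = 2" | "x = 1 \<and> y = 3" | "x = 2 \<and> y = 3" | "x = 3 \<and> y = 1"
    by auto
  then show ?thesis
  proof cases
    case 1
    \<comment> \<open>In all four cases, entry \<open>j\<close> of the list is the combination of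
      secret symbols added to noise symbol \<open>j\<close> in the two signals of the pair. Where
      both signals contain the symbol the combinations agree, and a symbol in neither signal gets
      0.\<close>
    show ?thesis
      by (rule window_secureI[where h="\<lambda>s j. [s 3, s 1, s 0, s 1, s 2, s 3, s 2, 0] ! j"], rule pair)
        (simp_all only: 1 rows list.inject, (simp_all add: parity)?, ((intro conjI)?; argo)+)
  next
    case 2
    show ?thesis
      by (rule window_secureI[where h="\<lambda>s j. [s 3, s 1, s 0, s 1, 0, 0, s 0, s 2] ! j"], rule pair)
        (simp_all only: 2 rows list.inject, (simp_all add: parity)?, ((intro conjI)?; argo)+)
  next
    case 3
    show ?thesis
      by (rule window_secureI[where h="\<lambda>s j. [0, s 0, 0, 0, 0, 0, s 0, s 2] ! j"], rule pair)
        (simp_all only: 3 rows list.inject, (simp_all add: parity)?, ((intro conjI)?; argo)+)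
  next
    case 4
    show ?thesis
      by (rule window_secureI[where h="\<lambda>s j. [0, 0, s 0 + s 2, s 0 + s 1, s 3, s 1 + s 3, 0, 0] ! j"],
          rule pair)
        (simp_all only: 4 rows list.inject, (simp_all add: parity)?, ((intro conjI)?; argo)+)
  qed
qed

text \<open>Adding the coordinates masked by the same noise symbol cancels the noise and leaves four
  independent combinations of the secret symbols. In the order of the pairs, these are
  \<open>s 3, s 1, s 2, s 0\<close>; \<open>s 0, s 0 + s 2, s 0 + s 1, s 3\<close>;
  \<open>s 0, s 1, s 2, s 3\<close>; \<open>s 0, s 2 + s 3, s 1, s 2\<close>; and
  \<open>s 3, s 1 + s 3, s 0, s 2\<close>.\<close>

lemma window_correct:
  assumes "(x, y) \<in> {(1, 1), (2, 1), (2, 2), (3, 2), (3, 3)}"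
  shows "shannon_cond_entropy window_scheme secret (signal_pair window_scheme x y) = 0"
proof -
  have "secret \<omega> = secret \<omega>'"
    if \<omega>: "\<omega> \<in> outcomes window_scheme" "\<omega>' \<in> outcomes window_scheme"
      and eq: "signal_pair window_scheme x y \<omega> = signal_pair window_scheme x y \<omega>'" for \<omega> \<omega>'
  proof (rule PiE_ext)
    show s: "secret \<omega> \<in> {..<4} \<rightarrow>\<^sub>E {0, 1}" "secret \<omega>' \<in> {..<4} \<rightarrow>\<^sub>E {0, 1}"
      using \<omega> outcomes_windowD(1) by blast+
    fix j :: nat assume j: "j \<in> {..<4}"
    have A: "map (\<lambda>i. odd (signal_value window_scheme (A x) \<omega> i)) [0, 1, 2, 3, 4] =
        map (\<lambda>i. odd (signal_value window_scheme (A x) \<omega>' i)) [0, 1, 2, 3, 4]"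
      and B: "map (\<lambda>i. odd (signal_value window_scheme (B y) \<omega> i)) [0, 1, 2, 3, 4] =
        map (\<lambda>i. odd (signal_value window_scheme (B y) \<omega>' i)) [0, 1, 2, 3, 4]"
      using eq by (simp_all add: signal_pair_def)
    note rows = signal_window_parity[OF \<omega>(1)] signal_window_parity[OF \<omega>(2)]
    from assms consider "x = 1 \<and> y = 1" | "x = 2 \<and> y = 1" | "x = 2 \<and> y = 2" | "x = 3 \<and> y = 2" | "x = 3 \<and> y = 3"
      by auto
    then have "odd (secret \<omega> 0) = odd (secret \<omega>' 0) \<and> odd (secret \<omega> 1) = odd (secret \<omega>' 1) \<and>
        odd (secret \<omega> 2) = odd (secret \<omega>' 2) \<and> odd (secret \<omega> 3) = odd (secret \<omega>' 3)"
    proof cases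
      case 1
      then show ?thesis using A B by (simp_all only: rows list.inject) (intro conjI; argo)
    next
      case 2
      then show ?thesis using A B by (simp_all only: rows list.inject) (intro conjI; argo)
    next
      case 3
      then show ?thesis using A B by (simp_all only: rows list.inject) (intro conjI; argo)
    next
      case 4
      then show ?thesis using A B by (simp_all only: rows list.inject) (intro conjI; argo)
    next
      case 5
      then show ?thesis using A B by (simp_all only: rows list.inject) (intro conjI; argo)
    qed
    moreover have "j = 0 \<or> j = 1 \<or> j = 2 \<or> j = 3" using j by auto
    ultimately have "odd (secret \<omega> j) = odd (secret \<omega>' j)" by auto
    moreover have "secret \<omega> j < 2" "secret \<omega>' j < 2"
      using PiE_mem[OF s(1) j] PiE_mem[OF s(2) j] by auto
    ultimately show "secret \<omega> j = secret \<omega>' j" by presburger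
  qed
  then have "\<forall>\<omega>\<in>outcomes window_scheme. \<forall>\<omega>'\<in>outcomes window_scheme.
      signal_pair window_scheme x y \<omega> = signal_pair window_scheme x y \<omega>' \<longrightarrow> secret \<omega> = secret \<omega>'"
    by (intro ballI impI)
  moreover have "field (base_field window_scheme)" "finite (carrier (base_field window_scheme))"
    by (simp_all add: field_F2)
  ultimately show ?thesis
    by (simp only: decodable_iff)
qed

lemma linear_cds_scheme_window: "linear_cds_scheme example_cds window_scheme"
  unfolding linear_cds_scheme_def
proof (intro conjI ballI)
  show "field (base_field window_scheme)" by (simp add: field_F2)
  show "finite (carrier (base_field window_scheme))" "secret_len window_scheme > 0"
    "noise_len window_scheme > 0" "signal_len window_scheme > 0" by simp_all
  show "is_matrix (base_field window_scheme) (signal_len window_scheme) (secret_len window_scheme)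
      (secret_mat window_scheme v)"
    "is_matrix (base_field window_scheme) (signal_len window_scheme) (noise_len window_scheme)
      (noise_mat window_scheme v)" for v
    by (simp_all add: is_matrix_def of_bool_def)
  fix p assume "p \<in> index_pairs example_cds"
  then obtain x y where p: "p = (x, y)" "x \<in> {1, 2, 3}" "y \<in> {1, 2, 3}"
    by (auto simp: example_cds_def)
  have "(x, y) \<in> {(1, 1), (2, 1), (2, 2), (3, 2), (3, 3)} \<and> disclose example_cds (x, y) = 1 \<or>
      (x, y) \<in> {(1, 2), (1, 3), (2, 3), (3, 1)} \<and> disclose example_cds (x, y) = 0"
    using p by (auto simp: example_cds_def)
  then show "case p of (x, y) \<Rightarrow>
      (disclose example_cds (x, y) = 1 \<longrightarrow>
         shannon_cond_entropy window_scheme secret (signal_pair window_scheme x y) = 0) \<and>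
      (disclose example_cds (x, y) = 0 \<longrightarrow>
         shannon_cond_entropy window_scheme secret (signal_pair window_scheme x y) =
         shannon_entropy window_scheme secret)"
    using window_correct[of x y] window_secure[of x y] p(1) by auto
qed

theorem theorem2:
  shows "linear_capacity example_cds = ereal (2 / 5)"
  unfolding linear_capacity_def
proof (rule antisym)
  show "(SUP \<sigma>\<in>{\<sigma>. linear_cds_scheme example_cds \<sigma>}. ereal (rate \<sigma>)) \<le> ereal (2 / 5)"
  proof (rule SUP_least)
    fix \<sigma> assume "\<sigma> \<in> {\<sigma>. linear_cds_scheme example_cds \<sigma>}"
    then have \<sigma>: "linear_cds_scheme example_cds \<sigma>" by simp
    \<comment> \<open>The rate has the signal length in its denominator; positivity allows the bound
      \<open>5 L \<le> 4 N\<close> to be divided by \<open>10 N\<close>.\<close>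
    then have "signal_len \<sigma> > 0" by (simp add: linear_cds_scheme_def)
    moreover have "5 * real (secret_len \<sigma>) \<le> 4 * real (signal_len \<sigma>)"
      using secret_len_bound[OF \<sigma>] by linarith
    ultimately show "ereal (rate \<sigma>) \<le> ereal (2 / 5)"
      by (simp add: rate_def field_simps)
  qed
  have "rate window_scheme = 2 / 5" by (simp add: rate_def)
  then show "ereal (2 / 5) \<le> (SUP \<sigma>\<in>{\<sigma>. linear_cds_scheme example_cds \<sigma>}. ereal (rate \<sigma>))"
    using linear_cds_scheme_window by (intro SUP_upper2[of window_scheme]) auto
qed

end
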